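(* Let $p\ge 3$. Let $\mathcal{C}$ be a $C^3$ curve and let $\mathbf{v}^0$ be initial data on $\mathcal{C}$. Let the approximate normals $\hat{\mathbf{n}}^j$, $j\ge 1$, satisfy the following: there are a constant $C_1$, independent of $i$ and $j$, and parameters $\xi^j_K$ such that for all $j\ge1$, all $i\in\mathbb{Z}$ and all $K\in I_{2i}\cup I_{2i+1}$, $$\hat{\mathbf{n}}^j_K=\mathbf{n}(\xi^j_K),\qquad |\xi^j_K-s^{j-1}_k|\le C_1\|\Delta s^{j-1}\|_{I_i}\quad\text{for all }k\in I_i,$$ and in addition $$|s^j_K-\xi^j_K|\le C_1\|\Delta s^{j-1}\|_{I_i}.$$ If the $S_p$ normal multi-scale transform for $\mathcal{C}$ with initial data $\mathbf{v}^0$ and normals $\hat{\mathbf{n}}^j$ is well-posed and convergent, then the normal re-parametrization is $C^{2,1-}$.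
   Context: Curve. $\mathcal{C}$ is a rectifiable, non-self-intersecting, closed planar curve of length $L$, given by its regular $C^1$ arc-length parametrization $\mathbf{v}(s)$, $s\in[0,L]$, extended $L$-periodically to $\mathbb{R}$. "$\mathcal{C}$ is $C^k$" means that $\mathbf{v}$ is $C^k$ (as a periodic function). $\mathbf{n}(s)=\mathbf{v}'(s)^\perp$ is the unit normal at $\mathbf{v}(s)$, where $\perp$ is rotation by $\pi/2$ in a fixed direction. Initial data. $\mathbf{v}^0_i=\mathbf{v}(s^0_i)$, $i=0,\dots,N-1$, with $s^0_0<s^0_1<\dots<s^0_{N-1}<s^0_0+L$, extended by $\mathbf{v}^0_{i+N}=\mathbf{v}^0_i$, $s^0_{i+N}=s^0_i+L$ for all $i\in\mathbb{Z}$. Subdivision operators. On sequences indexed by $\mathbb{Z}$ (componentwise for $\mathbb{R}^2$-valued ones), $(S_0x)_{2i}=(S_0x)_{2i+1}=x_i$ and $(S_px)_i=\frac12\big((S_{p-1}x)_i+(S_{p-1}x)_{i+1}\big)$ for $p\ge1$. Notation. $\Delta x_i=x_{i+1}-x_i$; $I=\{0,1,\dots,p+1\}$, $I_i=i+I$; $\|x\|_{I_i}=\max_{k\in I_i}|x_k|$. $S_p$ normal multi-scale transform. Given unit vectors $\hat{\mathbf{n}}^j_K$, for $j\ge1$ one sets $$\mathbf{v}^j_K=(S_p\mathbf{v}^{j-1})_K+d^j_K\hat{\mathbf{n}}^j_K,\qquad K\in\mathbb{Z},$$ where the scalars $d^j_K$ are such that $\mathbf{v}^j_K=\mathbf{v}(s^j_K)$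 lies on $\mathcal{C}$; here $s^j$ is the resulting sequence of arc-length parameters, with $s^j_{i+2^jN}=s^j_i+L$. The transform is well-posed if all $\mathbf{v}^j$ exist and each $s^j$ is strictly increasing. It is convergent if the piecewise linear interpolants $s^j(t)$, with $s^j(2^{-j}i)=s^j_i$, converge uniformly as $j\to\infty$ to a continuous function $s(t)$. The normal re-parametrization of $\mathcal{C}$ is $t\mapsto\mathbf{v}(s(t))$ (the limit of the piecewise linear interpolants of $\mathbf{v}^j$ on the grids $2^{-j}\mathbb{Z}$). $C^{k,1-}$ means $C^{k,\alpha}$ (Hölder) for all $\alpha\in(0,1)$. *)

theory Defs
  imports "HOL-Analysis.Analysis"
begin

section \<open>Smoothness classes\<close>

definition nth_deriv :: "nat \<Rightarrow> (real \<Rightarrow> 'a::real_normed_vector) \<Rightarrow> real \<Rightarrow> 'a" where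
  "nth_deriv k f = ((\<lambda>g t. vector_derivative g (at t)) ^^ k) f"

definition Ck :: "nat \<Rightarrow> (real \<Rightarrow> 'a::real_normed_vector) \<Rightarrow> bool" where
  "Ck k f \<longleftrightarrow>
     (\<forall>m<k. \<forall>t. nth_deriv m f differentiable (at t)) \<and> continuous_on UNIV (nth_deriv k f)"

(* The Hoelder bound is global on the line; for the periodic functions considered here
   this is the same as a local bound. *)
definition Ck_Hoelder :: "nat \<Rightarrow> real \<Rightarrow> (real \<Rightarrow> 'a::real_normed_vector) \<Rightarrow> bool" where
  "Ck_Hoelder k \<alpha> f \<longleftrightarrow>
     Ck k f \<and> (\<exists>M. \<forall>x y. norm (nth_deriv k f x - nth_deriv k f y) \<le> M * \<bar>x - y\<bar> powr \<alpha>)"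

definition Ck_1minus :: "nat \<Rightarrow> (real \<Rightarrow> 'a::real_normed_vector) \<Rightarrow> bool" where
  "Ck_1minus k f \<longleftrightarrow> (\<forall>\<alpha>. 0 < \<alpha> \<and> \<alpha> < 1 \<longrightarrow> Ck_Hoelder k \<alpha> f)"

section \<open>Closed curves and their normals\<close>

(* The plane is the type complex. Unit speed makes v an arc-length parametrization, so that
   the curve is rectifiable and has length L. *)
definition closed_arclength_curve :: "(real \<Rightarrow> complex) \<Rightarrow> real \<Rightarrow> bool" where
  "closed_arclength_curve v L \<longleftrightarrow>
     0 < L \<and> Ck 1 v \<and> (\<forall>s. norm (vector_derivative v (at s)) = 1) \<and>
     (\<forall>s. v (s + L) = v s) \<and> inj_on v {0..<L}"

(* Multiplication by \<i> or by -\<i> is the rotation by pi/2 in one of the two directions. *)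
definition quarter_turn :: "complex \<Rightarrow> bool" where
  "quarter_turn \<rho> \<longleftrightarrow> \<rho> = \<i> \<or> \<rho> = -\<i>"

definition unit_normal :: "complex \<Rightarrow> (real \<Rightarrow> complex) \<Rightarrow> real \<Rightarrow> complex" where
  "unit_normal \<rho> v s = \<rho> * vector_derivative v (at s)"

section \<open>Sequences indexed by the integers\<close>

(* div rounds down on int, so entries 2i and 2i+1 of subdiv 0 x are both x i. *)
primrec subdiv :: "nat \<Rightarrow> (int \<Rightarrow> 'a::real_vector) \<Rightarrow> int \<Rightarrow> 'a" where
  "subdiv 0 x = (\<lambda>i. x (i div 2))"
| "subdiv (Suc p) x = (\<lambda>i. (1/2) *\<^sub>R (subdiv p x i + subdiv p x (i + 1)))"

definition fwd_diff :: "(int \<Rightarrow> 'a::ab_group_add) \<Rightarrow> int \<Rightarrow> 'a" where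
  "fwd_diff x i = x (i + 1) - x i"

definition stencil :: "nat \<Rightarrow> int \<Rightarrow> int set" where
  "stencil p i = {i..i + int p + 1}"

definition local_norm :: "int set \<Rightarrow> (int \<Rightarrow> real) \<Rightarrow> real" where
  "local_norm A x = Max ((\<lambda>k. \<bar>x k\<bar>) ` A)"

definition pl_interp :: "nat \<Rightarrow> (int \<Rightarrow> real) \<Rightarrow> real \<Rightarrow> real" where
  "pl_interp j x t =
     (let i = \<lfloor>2^j * t\<rfloor>; \<theta> = frac (2^j * t) in (1 - \<theta>) * x i + \<theta> * x (i + 1))"

section \<open>The normal multi-scale transform\<close>

definition initial_params :: "real \<Rightarrow> nat \<Rightarrow> (int \<Rightarrow> real) \<Rightarrow> bool" where
  "initial_params L N x \<longleftrightarrow>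
     0 < N \<and> strict_mono_on {0..<int N} x \<and> x (int N - 1) < x 0 + L \<and>
     (\<forall>i. x (i + int N) = x i + L)"

(* The points of level j are v (s j i); level 0 is the initial data. *)
definition normal_transform ::
    "nat \<Rightarrow> (real \<Rightarrow> complex) \<Rightarrow> real \<Rightarrow> nat \<Rightarrow> (int \<Rightarrow> real) \<Rightarrow> (nat \<Rightarrow> int \<Rightarrow> complex) \<Rightarrow>
     (nat \<Rightarrow> int \<Rightarrow> real) \<Rightarrow> (nat \<Rightarrow> int \<Rightarrow> real) \<Rightarrow> bool" where
  "normal_transform p v L N s0 nhat d s \<longleftrightarrow>
     s 0 = s0 \<and>
     (\<forall>j\<ge>1. \<forall>K. norm (nhat j K) = 1 \<and>
        v (s j K) = subdiv p (\<lambda>i. v (s (j - 1) i)) K + d j K *\<^sub>R nhat j K) \<and>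
     (\<forall>j i. s j (i + 2^j * int N) = s j i + L)"

definition well_posed_transform ::
    "nat \<Rightarrow> (real \<Rightarrow> complex) \<Rightarrow> real \<Rightarrow> nat \<Rightarrow> (int \<Rightarrow> real) \<Rightarrow> (nat \<Rightarrow> int \<Rightarrow> complex) \<Rightarrow>
     (nat \<Rightarrow> int \<Rightarrow> real) \<Rightarrow> (nat \<Rightarrow> int \<Rightarrow> real) \<Rightarrow> bool" where
  "well_posed_transform p v L N s0 nhat d s \<longleftrightarrow>
     normal_transform p v L N s0 nhat d s \<and> (\<forall>j. strict_mono (s j))"

definition convergent_transform :: "(nat \<Rightarrow> int \<Rightarrow> real) \<Rightarrow> bool" where
  "convergent_transform s \<longleftrightarrow>
     (\<exists>\<sigma>. continuous_on UNIV \<sigma> \<and>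
        uniform_limit UNIV (\<lambda>j. pl_interp j (s j)) \<sigma> sequentially)"

definition normal_reparam ::
    "(real \<Rightarrow> complex) \<Rightarrow> (nat \<Rightarrow> int \<Rightarrow> real) \<Rightarrow> real \<Rightarrow> complex" where
  "normal_reparam v s t = v (lim (\<lambda>j. pl_interp j (s j) t))"

end

(* Let T be the tangent at the parameter xi of an approximate normal. Since v'' is orthogonal to v',
   the function s -> (v(s) - v(xi)) . T agrees with s - xi up to third order, so pairing the defining
   equation of the transform with T shows that the parameters satisfy a linear B-spline subdivision
   with cubic error, s^j = S_p s^(j-1) + O(delta^3) with delta the largest increment at level j-1.
   Convergence forces delta -> 0, and then the recursion gives delta = O(2^-j), so that the error is
   O(8^-j). As the m-th difference of S_p x is 2^-m S_(p-m) applied to the m-th difference of x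
   and p >= 3, the second differences of s^j are O(4^-j) and the third ones O(j 8^-j): the loss of
   the factor j costs the endpoint of the Hoelder scale. Hence s is C^{2,1-}, and so is v o s. *)
theory Submission
  imports Defs
begin

section \<open>Differences of subdivided sequences\<close>

text \<open>The increments obey \<open>\<delta>' \<le> \<delta> / 2 + 2 * C * \<delta> ^ 3\<close>,
  which contracts only for small \<open>\<delta>\<close>, while the initial data give no more than
  \<open>\<delta> \<le> L\<close>. This is why smallness at one level has to be drawn from uniform
  convergence before any rate is available. The smoothness of the limit is obtained by elementary
  means. The r-th differences of \<open>s j\<close>, scaled by \<open>2 ^ (r * j)\<close>, are read
  as step functions on dyadic cells. They follow S_(p-r), and averaging moves an entry by at most a
  fixed multiple of the largest increment; that increment is \<open>(1/2) ^ j\<close> times a scaled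
  difference of order r + 1. So order 3 serves only to control order 2, and its growth, linear in j,
  is absorbed by \<open>2 powr ((1 - \<alpha>) * j)\<close>.\<close>

lemma subdiv_add: "subdiv q (\<lambda>i. x i + y i) K = subdiv q x K + subdiv q y K"
  by (induction q arbitrary: K) (auto simp: algebra_simps)

lemma subdiv_const: "subdiv q (\<lambda>i. c) K = c"
  by (induction q arbitrary: K) (auto simp: scaleR_2 [symmetric])

lemma subdiv_linear: "linear f \<Longrightarrow> subdiv q (\<lambda>i. f (x i)) K = f (subdiv q x K)"
  by (induction q arbitrary: K) (auto simp: linear_add linear_scale scaleR_right_distrib)

lemma subdiv_shift: "subdiv q x (K + 2) = subdiv q (\<lambda>i. x (i + 1)) K"
proof (induction q arbitrary: K)
  case (Suc q)
  have "K + 2 + 1 = K + 1 + 2" by simp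
  then show ?case using Suc[of K] Suc[of "K + 1"] by (simp del: add.assoc)
qed simp

text \<open>Iterated averaging yields a convex combination of the coarse entries in exactly this
  index range. The range is kept explicit because the approximate normals are controlled only on a
  stencil.\<close>

lemma subdiv_norm_le:
  assumes "\<And>k. K div 2 \<le> k \<Longrightarrow> k \<le> (K + int q) div 2 \<Longrightarrow> norm (x k) \<le> B"
  shows "norm (subdiv q x K) \<le> B"
  using assms
proof (induction q arbitrary: K)
  case (Suc q)
  have "norm (subdiv q x K) \<le> B"
    by (rule Suc.IH) (rule Suc.prems, auto)
  moreover have "norm (subdiv q x (K + 1)) \<le> B"
    by (rule Suc.IH) (rule Suc.prems, auto simp: algebra_simps)
  ultimately have "norm (subdiv q x K + subdiv q x (K + 1)) \<le> 2 * B"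
    by norm
  then show ?case by simp
qed simp

text \<open>An averaging step joins two entries whose reference values coincide or are neighbours,
  so the error grows by at most \<open>B / 2\<close>. Since \<open>K div 2\<close> is the coarse
  cell containing the fine cell \<open>K\<close>, this compares the step functions of consecutive
  levels.\<close>

lemma subdiv_near:
  assumes "\<And>k. norm (fwd_diff x k) \<le> B"
  shows "norm (subdiv q x K - x (K div 2)) \<le> real q * B"
proof (induction q arbitrary: K)
  case (Suc q)
  have "0 \<le> B" using order_trans[OF norm_ge_zero assms[of 0]] .
  have step: "norm (x ((K + 1) div 2) - x (K div 2)) \<le> B"
  proof (cases "even K")
    case True
    then have "(K + 1) div 2 = K div 2" by auto
    then show ?thesis using \<open>0 \<le> B\<close> by simp
  next
    case False
    then have "(K + 1) div 2 = K div 2 + 1" by presburger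
    then show ?thesis using assms[of "K div 2"] by (simp add: fwd_diff_def)
  qed
  have "subdiv (Suc q) x K - x (K div 2) =
      (1/2) *\<^sub>R ((subdiv q x K - x (K div 2)) + (subdiv q x (K + 1) - x ((K + 1) div 2))
        + (x ((K + 1) div 2) - x (K div 2)))"
    by (simp add: algebra_simps scaleR_half_double flip: scaleR_2)
  also have "norm \<dots> \<le> (1/2) * (real q * B + real q * B + B)"
    unfolding norm_scaleR using Suc.IH[of K] Suc.IH[of "K + 1"] step
    by (intro mult_mono norm_triangle_le add_mono) auto
  also have "\<dots> \<le> real (Suc q) * B"
    using \<open>0 \<le> B\<close> by (simp add: algebra_simps)
  finally show ?case .
qed simp

text \<open>Consecutive averages share their middle term, so their difference is half of
  \<open>subdiv q x (K + 2) - subdiv q x K\<close>, and two fine places are one coarse place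
  (\<open>subdiv_shift\<close>).\<close>

lemma fwd_diff_subdiv:
  "fwd_diff (subdiv (Suc q) x) = (\<lambda>K. (1/2) *\<^sub>R subdiv q (fwd_diff x) K)"
proof
  fix K
  have "subdiv q (\<lambda>i. x (i + 1)) K = subdiv q (fwd_diff x) K + subdiv q x K"
    using subdiv_add[of q "fwd_diff x" x K] by (simp add: fwd_diff_def)
  then have "subdiv q x (K + 2) = subdiv q (fwd_diff x) K + subdiv q x K"
    by (simp add: subdiv_shift)
  moreover have "K + 1 + 1 = K + 2" by simp
  ultimately show "fwd_diff (subdiv (Suc q) x) K = (1/2) *\<^sub>R subdiv q (fwd_diff x) K"
    by (simp add: fwd_diff_def[of "\<lambda>K. _ K"] algebra_simps)
qed

lemma fwd_diff_scaleR: "fwd_diff (\<lambda>i. c *\<^sub>R (x i :: 'a::real_vector)) = (\<lambda>i. c *\<^sub>R fwd_diff x i)"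
  by (rule ext) (simp add: fwd_diff_def scaleR_right_diff_distrib)

lemma fwd_diff_mult: "fwd_diff (\<lambda>i. c * x i) = (\<lambda>i. c * fwd_diff x i :: real)"
  by (rule ext) (simp add: fwd_diff_def algebra_simps)

lemma fwd_diffs_subdiv:
  "(fwd_diff ^^ r) (subdiv (q + r) x) =
     (\<lambda>K. (1/2) ^ r *\<^sub>R subdiv q ((fwd_diff ^^ r) x) K)"
proof (induction r arbitrary: q)
  case (Suc r)
  show ?case
    using Suc.IH[of "Suc q"] by (simp add: fwd_diff_scaleR fwd_diff_subdiv del: subdiv.simps)
qed simp

lemma fwd_diffs_diff:
  "(fwd_diff ^^ r) (\<lambda>i. x i - y i) = (\<lambda>i. (fwd_diff ^^ r) x i - (fwd_diff ^^ r) y i)"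
proof (induction r)
  case (Suc r)
  then show ?case by (auto simp: fwd_diff_def)
qed simp

lemma fwd_diffs_bound:
  fixes x :: "int \<Rightarrow> real"
  assumes "\<And>i. \<bar>x i\<bar> \<le> e"
  shows "\<bar>(fwd_diff ^^ r) x i\<bar> \<le> 2 ^ r * e"
proof (induction r arbitrary: i)
  case (Suc r)
  show ?case using Suc[of i] Suc[of "i + 1"] by (simp add: fwd_diff_def)
qed (use assms in simp)

text \<open>The extra weight \<open>2 ^ r\<close> per level cancels the factor
  \<open>(1/2) ^ r\<close> of \<open>fwd_diffs_subdiv\<close>. In the error, \<open>4 ^ r\<close>
  collects this weight and the factor \<open>2 ^ r\<close> lost in taking r differences of the
  perturbation.\<close>

lemma scaled_diffs_step:
  fixes s s' :: "int \<Rightarrow> real"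
  assumes "\<And>K. \<bar>s' K - subdiv p s K\<bar> \<le> A * (1/8) ^ j" and "r \<le> p"
  shows "\<bar>2 ^ (r * Suc j) * (fwd_diff ^^ r) s' K
           - subdiv (p - r) (\<lambda>i. 2 ^ (r * j) * (fwd_diff ^^ r) s i) K\<bar>
         \<le> 4 ^ r * A * (2 ^ r / 8) ^ j"
proof -
  have "(fwd_diff ^^ r) (\<lambda>i. s' i - subdiv p s i) K
        = (fwd_diff ^^ r) s' K - (1/2) ^ r * subdiv (p - r) ((fwd_diff ^^ r) s) K"
    using fwd_diffs_subdiv[of r "p - r" s] \<open>r \<le> p\<close> by (simp add: fwd_diffs_diff)
  then have "\<bar>(fwd_diff ^^ r) s' K - (1/2) ^ r * subdiv (p - r) ((fwd_diff ^^ r) s) K\<bar>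
      \<le> 2 ^ r * (A * (1/8) ^ j)"
    using fwd_diffs_bound[where x = "\<lambda>i. s' i - subdiv p s i" and r = r and i = K, OF assms(1)] by simp
  then have "2 ^ (r * Suc j)
        * \<bar>(fwd_diff ^^ r) s' K - (1/2) ^ r * subdiv (p - r) ((fwd_diff ^^ r) s) K\<bar>
      \<le> 2 ^ (r * Suc j) * (2 ^ r * (A * (1/8) ^ j))"
    by (rule mult_left_mono) simp
  also have "\<dots> = 4 ^ r * A * (2 ^ r / 8) ^ j"
  proof -
    have "(4 :: real) ^ r = 2 ^ r * 2 ^ r" by (simp flip: power_mult_distrib)
    moreover have "((2 :: real) ^ r / 8) ^ j = 2 ^ (r * j) * (1/8) ^ j"
      by (simp add: power_divide power_mult)
    ultimately show ?thesis by (simp add: power_add)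
  qed
  also have "2 ^ (r * Suc j)
        * \<bar>(fwd_diff ^^ r) s' K - (1/2) ^ r * subdiv (p - r) ((fwd_diff ^^ r) s) K\<bar>
      = \<bar>2 ^ (r * Suc j) * (fwd_diff ^^ r) s' K
         - 2 ^ (r * Suc j) * ((1/2) ^ r * subdiv (p - r) ((fwd_diff ^^ r) s) K)\<bar>"
    by (simp only: abs_mult power_abs abs_numeral flip: right_diff_distrib)
  also have "2 ^ (r * Suc j) * ((1/2) ^ r * subdiv (p - r) ((fwd_diff ^^ r) s) K)
      = subdiv (p - r) (\<lambda>i. 2 ^ (r * j) * (fwd_diff ^^ r) s i) K"
    using subdiv_linear[where f = "\<lambda>x. 2 ^ (r * j) * x" and q = "p - r" and x = "(fwd_diff ^^ r) s"
        and K = K]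
    by (simp add: power_add power_divide field_simps linear_iff)
  finally show ?thesis .
qed

text \<open>Convex combinations do not raise the bound \<open>M\<close>; only the perturbation is
  added.\<close>

lemma scaled_diffs_bound:
  fixes s s' :: "int \<Rightarrow> real"
  assumes "\<And>K. \<bar>s' K - subdiv p s K\<bar> \<le> A * (1/8) ^ j" and "r \<le> p"
    and "\<And>i. \<bar>2 ^ (r * j) * (fwd_diff ^^ r) s i\<bar> \<le> M"
  shows "\<bar>2 ^ (r * Suc j) * (fwd_diff ^^ r) s' K\<bar> \<le> M + 4 ^ r * A * (2 ^ r / 8) ^ j"
proof -
  have "\<bar>subdiv (p - r) (\<lambda>i. 2 ^ (r * j) * (fwd_diff ^^ r) s i) K\<bar> \<le> M"
    using subdiv_norm_le[of K "p - r" "\<lambda>i. 2 ^ (r * j) * (fwd_diff ^^ r) s i" M] assms(3) by simp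
  then show ?thesis
    using scaled_diffs_step[OF assms(1) \<open>r \<le> p\<close>, of K] by linarith
qed

section \<open>Decay of differences under a cubic perturbation\<close>

text \<open>From a level \<open>J\<close> with small increments on, halving dominates and the cubic
  errors are summable relative to the rate; the finitely many earlier levels are absorbed into
  \<open>B\<close>.\<close>

lemma increments_decay:
  fixes s :: "nat \<Rightarrow> int \<Rightarrow> real"
  assumes "1 \<le> p" "0 \<le> C"
    and bounded: "\<And>j i. \<bar>fwd_diff (s j) i\<bar> \<le> L"
    and step: "\<And>j \<delta> K. (\<And>i. \<bar>fwd_diff (s j) i\<bar> \<le> \<delta>) \<Longrightarrow>
                 \<bar>s (Suc j) K - subdiv p (s j) K\<bar> \<le> C * \<delta> ^ 3"
    and small: "\<And>\<epsilon>. 0 < \<epsilon> \<Longrightarrow> \<exists>J. \<forall>i. \<bar>fwd_diff (s J) i\<bar> \<le> \<epsilon>"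
  obtains B where "0 \<le> B" "\<And>j i. \<bar>fwd_diff (s j) i\<bar> \<le> B * (1/2) ^ j"
proof -
  \<comment> \<open>The requirement is \<open>32 * C * \<epsilon>\<^sup>2 \<le> 3/4\<close>: then
    \<open>2 - h + 3/4 * h\<close> is at most the room \<open>2 - (1/4) ^ Suc k\<close> that the
    next level allows.\<close>
  define \<epsilon> where "\<epsilon> = 1 / (8 * (1 + C))"
  have "0 < \<epsilon>" using \<open>0 \<le> C\<close> by (simp add: \<epsilon>_def)
  have "C \<le> (1 + C)\<^sup>2"
    using \<open>0 \<le> C\<close> by (simp add: power2_eq_square algebra_simps)
  then have \<epsilon>: "32 * C * \<epsilon>\<^sup>2 \<le> 3/4"
    using \<open>0 \<le> C\<close> unfolding \<epsilon>_def power_divide power_mult_distrib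
    by (simp add: divide_simps power_mult_distrib)
  obtain J where J: "\<And>i. \<bar>fwd_diff (s J) i\<bar> \<le> \<epsilon>"
    using small[OF \<open>0 < \<epsilon>\<close>] by blast
  \<comment> \<open>The factor \<open>2 - (1/4) ^ k\<close> leaves room for the accumulated cubic errors.\<close>
  define \<delta> where "\<delta> k = \<epsilon> * (2 - (1/4) ^ k) * (1/2) ^ k" for k
  have tail: "\<bar>fwd_diff (s (J + k)) i\<bar> \<le> \<delta> k" for k i
  proof (induction k arbitrary: i)
    case 0
    then show ?case using J by (simp add: \<delta>_def)
  next
    case (Suc k)
    define h :: real where "h = (1/4) ^ k"
    have h: "0 \<le> h" "h \<le> 1" by (simp_all add: h_def power_le_one)
    have "\<delta> k ^ 3 \<le> (\<epsilon> * 2 * (1/2) ^ k) ^ 3"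
      unfolding \<delta>_def h_def [symmetric] using h \<open>0 < \<epsilon>\<close>
      by (intro power_mono mult_right_mono mult_left_mono) auto
    also have "\<dots> = 8 * \<epsilon> ^ 3 * (1/2) ^ k * h"
    proof -
      have "h = (1/2) ^ k * (1/2) ^ k" by (simp add: h_def flip: power_mult_distrib)
      then show ?thesis by (simp only: power3_eq_cube) simp
    qed
    finally have cube: "\<delta> k ^ 3 \<le> 8 * \<epsilon> ^ 3 * (1/2) ^ k * h" .
    \<comment> \<open>\<open>scaled_diffs_bound\<close> is applied to a single step with
      \<open>j = 0\<close>, so that its weights are trivial and \<open>A\<close> carries the whole
      cubic error.\<close>
    have "2 * \<bar>fwd_diff (s (Suc (J + k))) i\<bar> \<le> \<delta> k + 4 * (C * \<delta> k ^ 3)"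
      using scaled_diffs_bound[where r = 1 and j = 0 and M = "\<delta> k", OF _ \<open>1 \<le> p\<close>,
          where s = "s (J + k)" and s' = "s (Suc (J + k))" and A = "C * \<delta> k ^ 3" and K = i]
        step[OF Suc.IH] Suc.IH by (simp add: abs_mult)
    also have "\<dots> \<le> \<delta> k + 4 * (C * (8 * \<epsilon> ^ 3 * (1/2) ^ k * h))"
      using cube \<open>0 \<le> C\<close> by (intro add_left_mono mult_left_mono) auto
    also have "\<dots> = \<epsilon> * (1/2) ^ k * (2 - h + (32 * C * \<epsilon>\<^sup>2) * h)"
      by (simp add: \<delta>_def h_def power2_eq_square power3_eq_cube algebra_simps)
    also have "\<dots> \<le> \<epsilon> * (1/2) ^ k * (2 - h + 3/4 * h)"
      using \<epsilon> h \<open>0 < \<epsilon>\<close> by (intro mult_left_mono add_left_mono mult_right_mono) auto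
    also have "\<dots> = 2 * \<delta> (Suc k)"
      by (simp add: \<delta>_def h_def algebra_simps)
    finally show ?case by simp
  qed
  \<comment> \<open>The first entry covers the levels before \<open>J\<close> by the crude bound
    \<open>L\<close>, the second one the levels from \<open>J\<close> on; \<open>2 ^ J\<close>
    compensates the shift of the index.\<close>
  define B where "B = max (L * 2 ^ J) (2 * \<epsilon> * 2 ^ J)"
  have "0 \<le> B" using \<open>0 < \<epsilon>\<close> by (simp add: B_def le_max_iff_disj)
  moreover have "\<bar>fwd_diff (s j) i\<bar> \<le> B * (1/2) ^ j" for j i
  proof (cases "J \<le> j")
    case True
    then obtain k where k: "j = J + k" using le_Suc_ex by blast
    have "\<delta> k \<le> \<epsilon> * 2 * (1/2) ^ k"
      unfolding \<delta>_def using \<open>0 < \<epsilon>\<close> by (intro mult_right_mono mult_left_mono) auto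
    also have "\<dots> = 2 * \<epsilon> * 2 ^ J * (1/2) ^ j"
      by (simp add: k power_add power_divide)
    also have "\<dots> \<le> B * (1/2) ^ j"
      by (intro mult_right_mono) (auto simp: B_def)
    finally show ?thesis using tail[of k i] k by simp
  next
    case False
    have "0 \<le> L" using bounded[of 0 0] by linarith
    have "(2::real) ^ j \<le> 2 ^ J" using False by (intro power_increasing) auto
    then have "L \<le> L * 2 ^ J * (1/2) ^ j"
      using \<open>0 \<le> L\<close> by (simp add: power_divide field_simps mult_left_mono)
    also have "\<dots> \<le> B * (1/2) ^ j"
      by (intro mult_right_mono) (auto simp: B_def)
    finally show ?thesis using bounded[of j i] by linarith
  qed
  ultimately show ?thesis using that by blast
qed

section \<open>Limits of dyadic step functions\<close>

lemma dyadic_floor: "\<lfloor>2 ^ Suc j * t\<rfloor> div 2 = \<lfloor>2 ^ j * (t :: real)\<rfloor>"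
  using floor_divide_real_eq_div[of 2 "2 ^ Suc j * t"] by simp

text \<open>Here \<open>x j i\<close> is the value of a step function on the cell from
  \<open>i / 2 ^ j\<close> to \<open>(i + 1) / 2 ^ j\<close>. The hypothesis \<open>step\<close>
  makes these functions converge geometrically, and \<open>diff\<close> bounds their jumps; the two
  rates agree, so comparing at the level that matches the distance of two points gives the Hoelder
  bound.\<close>

lemma dyadic_limit:
  fixes x :: "nat \<Rightarrow> int \<Rightarrow> real"
  assumes "0 < \<alpha>"
    and step: "\<And>j K. \<bar>x (Suc j) K - x j (K div 2)\<bar> \<le> A * (2 powr - \<alpha>) ^ j"
    and diff: "\<And>j i. \<bar>fwd_diff (x j) i\<bar> \<le> A * (2 powr - \<alpha>) ^ j"
    and bounded: "\<And>i. \<bar>x 0 i\<bar> \<le> M"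
  obtains X D H where "\<And>j t. \<bar>X t - x j \<lfloor>2 ^ j * t\<rfloor>\<bar> \<le> D * (2 powr - \<alpha>) ^ j"
    "bounded (range X)" "\<And>a b. \<bar>X a - X b\<bar> \<le> H * \<bar>a - b\<bar> powr \<alpha>"
proof -
  define \<theta> where "\<theta> = 2 powr - \<alpha>"
  have \<theta>: "0 < \<theta>" "\<theta> < 1"
    using \<open>0 < \<alpha>\<close> by (simp_all add: \<theta>_def powr_less_one)
  have "0 \<le> A" using order_trans[OF abs_ge_zero diff[of 0 0]] by simp
  define f where "f j t = x j \<lfloor>2 ^ j * t\<rfloor>" for j and t :: real
  define D where "D = A / (1 - \<theta>)"
  have "0 \<le> D" using \<open>0 \<le> A\<close> \<theta> by (simp add: D_def)
  have f_step: "\<bar>f (Suc j) t - f j t\<bar> \<le> A * \<theta> ^ j" for j t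
    using step[of j "\<lfloor>2 ^ Suc j * t\<rfloor>"] unfolding f_def \<theta>_def dyadic_floor .
  \<comment> \<open>Keeping the geometric sum in closed form lets the induction close
    exactly.\<close>
  have f_tail: "\<bar>f (j + k) t - f j t\<bar> \<le> D * \<theta> ^ j * (1 - \<theta> ^ k)" for j k t
  proof (induction k)
    case (Suc k)
    have "A * \<theta> ^ (j + k) = D * \<theta> ^ j * (\<theta> ^ k - \<theta> ^ Suc k)"
      using \<theta> by (simp add: D_def power_add field_simps)
    then show ?case
      using Suc f_step[of "j + k" t] by (simp add: algebra_simps)
  qed simp
  have f_tail': "\<bar>f (j + k) t - f j t\<bar> \<le> D * \<theta> ^ j" for j k t
    using f_tail[of j k t] \<open>0 \<le> D\<close> \<theta>
    by (smt (verit, best) mult_left_le mult_nonneg_nonneg zero_le_power)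
  have "(\<lambda>j. D * \<theta> ^ j) \<longlonglongrightarrow> 0"
    using \<theta> by (auto intro!: tendsto_mult_right_zero LIMSEQ_power_zero)
  have "Cauchy (\<lambda>j. f j t)" for t
  proof (rule CauchyI')
    fix e :: real assume "0 < e"
    with \<open>(\<lambda>j. D * \<theta> ^ j) \<longlonglongrightarrow> 0\<close> obtain j where j: "D * \<theta> ^ j < e / 2"
      by (metis (no_types, lifting) eventually_happens half_gt_zero order_tendstoD(2)
          sequentially_bot)
    have "dist (f m t) (f n t) < e" if "j \<le> m" "m < n" for m n
      using f_tail'[of j "m - j" t] f_tail'[of j "n - j" t] j that by (simp add: dist_real_def)
    then show "\<exists>M. \<forall>m\<ge>M. \<forall>n>m. dist (f m t) (f n t) < e" by blast
  qed
  then obtain X where X: "\<And>t. (\<lambda>j. f j t) \<longlonglongrightarrow> X t"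
    unfolding Cauchy_convergent_iff convergent_def by metis
  have near: "\<bar>X t - f j t\<bar> \<le> D * \<theta> ^ j" for j t
  proof (rule Lim_bounded)
    show "(\<lambda>k. \<bar>f (k + j) t - f j t\<bar>) \<longlonglongrightarrow> \<bar>X t - f j t\<bar>"
      by (intro tendsto_intros LIMSEQ_ignore_initial_segment X)
    show "\<forall>k\<ge>0. \<bar>f (k + j) t - f j t\<bar> \<le> D * \<theta> ^ j"
      using f_tail'[of j _ t] by (simp add: add.commute)
  qed
  define M' where "M' = M + D"
  have X_bounded: "\<bar>X t\<bar> \<le> M'" for t
    using near[of t 0] bounded[of "\<lfloor>t\<rfloor>"] by (simp add: f_def M'_def)
  \<comment> \<open>The first entry serves distances above 1, where boundedness suffices; the second
    one serves smaller distances.\<close>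
  define H where "H = max (2 * M') ((2 * D + A) * 2 powr \<alpha>)"
  have "\<bar>X a - X b\<bar> \<le> H * \<bar>a - b\<bar> powr \<alpha>" for a b
  proof -
    consider "a = b" | "1 < \<bar>a - b\<bar>" | "a \<noteq> b" "\<bar>a - b\<bar> \<le> 1" by linarith
    then show ?thesis
    proof cases
      case 1
      then show ?thesis by simp
    next
      case 2
      have "\<bar>X a - X b\<bar> \<le> 2 * M'" using X_bounded[of a] X_bounded[of b] by linarith
      also have "\<dots> \<le> H" by (simp add: H_def)
      also have "\<dots> \<le> H * \<bar>a - b\<bar> powr \<alpha>"
      proof -
        have "0 \<le> M'" using X_bounded[of 0] by linarith
        then have "0 \<le> H" by (simp add: H_def le_max_iff_disj)
        moreover have "1 \<le> \<bar>a - b\<bar> powr \<alpha>"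
          using 2 \<open>0 < \<alpha>\<close> by (intro ge_one_powr_ge_zero) auto
        ultimately show ?thesis by (simp add: mult_le_cancel_left1)
      qed
      finally show ?thesis .
    next
      case 3
      \<comment> \<open>The sought \<open>j\<close> is the last level whose cells are at least as
        long as the distance of \<open>a\<close> and \<open>b\<close>. The two points then lie in
        equal or adjacent cells, and \<open>\<theta> ^ j\<close> is comparable to the distance to
        the power \<open>\<alpha>\<close>.\<close>
      define P where "P n \<longleftrightarrow> (1/2) ^ n < \<bar>a - b\<bar>" for n :: nat
      have "\<exists>n. P n" unfolding P_def using 3 by (intro real_arch_pow_inv) auto
      moreover have "\<not> P 0" using 3 by (simp add: P_def)
      ultimately obtain j where "\<not> P j" "P (Suc j)"
        using nat_induct[of "\<lambda>n. \<not> P n"] by blast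
      then have j: "\<bar>a - b\<bar> \<le> (1/2) ^ j" "(1/2) ^ Suc j < \<bar>a - b\<bar>" by (auto simp: P_def)
      have "2 ^ j * \<bar>a - b\<bar> \<le> 1"
        using j(1) by (simp add: power_divide field_simps)
      then have "\<bar>2 ^ j * a - 2 ^ j * b\<bar> \<le> 1"
        by (simp add: abs_mult flip: right_diff_distrib)
      then have "\<lfloor>2 ^ j * a\<rfloor> = \<lfloor>2 ^ j * b\<rfloor> \<or> \<lfloor>2 ^ j * a\<rfloor> = \<lfloor>2 ^ j * b\<rfloor> + 1
          \<or> \<lfloor>2 ^ j * b\<rfloor> = \<lfloor>2 ^ j * a\<rfloor> + 1"
        by linarith
      then have "\<bar>f j a - f j b\<bar> \<le> A * \<theta> ^ j"
        using diff[of j "\<lfloor>2 ^ j * a\<rfloor>"] diff[of j "\<lfloor>2 ^ j * b\<rfloor>"] \<open>0 \<le> A\<close> \<theta>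
        by (auto simp: f_def fwd_diff_def \<theta>_def abs_minus_commute)
      then have "\<bar>X a - X b\<bar> \<le> (2 * D + A) * \<theta> ^ j"
        using near[of a j] near[of b j] by (simp add: algebra_simps)
      also have "\<theta> ^ j = 2 powr \<alpha> * ((1/2) ^ Suc j) powr \<alpha>"
      proof -
        have "(1/2 :: real) ^ Suc j = 2 powr - real (Suc j)"
          by (simp only: powr_minus powr_realpow zero_less_numeral inverse_eq_divide power_one_over)
        then have "2 powr \<alpha> * ((1/2) ^ Suc j) powr \<alpha> = 2 powr (\<alpha> + - real (Suc j) * \<alpha>)"
          by (simp only: powr_powr powr_add)
        moreover have "\<theta> ^ j = 2 powr (- \<alpha> * real j)"
          using \<theta>(1) by (simp add: \<theta>_def powr_powr flip: powr_realpow)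
        ultimately show ?thesis by (simp add: algebra_simps)
      qed
      also have "\<dots> \<le> 2 powr \<alpha> * \<bar>a - b\<bar> powr \<alpha>"
        using j(2) \<open>0 < \<alpha>\<close> by (intro mult_left_mono powr_mono2) auto
      also have "(2 * D + A) * (2 powr \<alpha> * \<bar>a - b\<bar> powr \<alpha>) \<le> H * \<bar>a - b\<bar> powr \<alpha>"
        unfolding mult.assoc [symmetric] by (intro mult_right_mono) (auto simp: H_def)
      finally show ?thesis using \<open>0 \<le> D\<close> \<open>0 \<le> A\<close> by (simp add: mult_left_mono)
    qed
  qed
  moreover have "bounded (range X)"
    using X_bounded by (auto simp: bounded_iff)
  ultimately show ?thesis
    using that near unfolding f_def \<theta>_def by blast
qed

text \<open>A discrete mean value inequality, by telescoping.\<close>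

lemma increments_near_slope:
  fixes x :: "int \<Rightarrow> real"
  assumes "m \<le> n" and "\<And>i. m \<le> i \<Longrightarrow> i < n \<Longrightarrow> \<bar>fwd_diff x i - c\<bar> \<le> \<delta>"
  shows "\<bar>x n - x m - c * (n - m)\<bar> \<le> \<delta> * (n - m)"
  using assms
proof (induction n rule: int_ge_induct)
  case (step n)
  then have "\<bar>x n - x m - c * (n - m)\<bar> \<le> \<delta> * (n - m)" by simp
  moreover have "\<bar>fwd_diff x n - c\<bar> \<le> \<delta>" using step by simp
  ultimately show ?case by (simp add: fwd_diff_def algebra_simps)
qed simp

text \<open>Step functions cannot be differentiated, so secants are used instead. Near
  \<open>t\<^sub>0\<close> all scaled increments are close to \<open>Y t\<^sub>0\<close>; summing
  them between the grid points \<open>m j / 2 ^ j\<close> and \<open>n j / 2 ^ j\<close> and letting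
  these tend to \<open>a\<close> and \<open>b\<close> bounds the secants of
  \<open>X\<close>.\<close>

lemma dyadic_limit_deriv:
  fixes x :: "nat \<Rightarrow> int \<Rightarrow> real"
  assumes X: "\<And>t. (\<lambda>j. x j \<lfloor>2 ^ j * t\<rfloor>) \<longlonglongrightarrow> X t"
    and Y: "uniform_limit UNIV (\<lambda>j t. 2 ^ j * fwd_diff (x j) \<lfloor>2 ^ j * t\<rfloor>) Y sequentially"
    and "isCont Y t\<^sub>0"
  shows "(X has_real_derivative Y t\<^sub>0) (at t\<^sub>0)"
proof -
  have close: "\<exists>\<eta>>0. \<forall>a b. \<bar>a - t\<^sub>0\<bar> < \<eta> \<longrightarrow> \<bar>b - t\<^sub>0\<bar> < \<eta> \<longrightarrow> a \<le> b
        \<longrightarrow> \<bar>X b - X a - Y t\<^sub>0 * (b - a)\<bar> \<le> e * (b - a)" if "0 < e" for e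
  proof -
    obtain \<eta>' where \<eta>': "0 < \<eta>'" "\<And>t. \<bar>t - t\<^sub>0\<bar> < \<eta>' \<Longrightarrow> \<bar>Y t - Y t\<^sub>0\<bar> < e / 2"
      using \<open>isCont Y t\<^sub>0\<close> \<open>0 < e\<close> unfolding continuous_at_eps_delta
      by (metis dist_real_def half_gt_zero)
    have "\<bar>X b - X a - Y t\<^sub>0 * (b - a)\<bar> \<le> e * (b - a)"
      if ab: "\<bar>a - t\<^sub>0\<bar> < \<eta>' / 2" "\<bar>b - t\<^sub>0\<bar> < \<eta>' / 2" "a \<le> b" for a b
    proof -
      define n m where "n j = \<lfloor>2 ^ j * b\<rfloor>" and "m j = \<lfloor>2 ^ j * a\<rfloor>" for j :: nat
      have "\<forall>\<^sub>F j in sequentially. \<forall>t. \<bar>2 ^ j * fwd_diff (x j) \<lfloor>2 ^ j * t\<rfloor> - Y t\<bar> < e / 2"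
        using uniform_limitD[OF Y, of "e / 2"] \<open>0 < e\<close> by (simp add: dist_real_def)
      \<comment> \<open>Rounding down may put the first grid point to the left of \<open>a\<close>,
        by less than \<open>(1/2) ^ j\<close>; the other half of \<open>\<eta>'\<close> makes room
        for this.\<close>
      moreover have "\<forall>\<^sub>F j in sequentially. (1/2) ^ j < \<eta>' / 2"
        using \<eta>'(1) by (intro order_tendstoD(2)[OF LIMSEQ_power_zero]) auto
      ultimately have "\<forall>\<^sub>F j in sequentially.
          \<bar>x j (n j) - x j (m j) - Y t\<^sub>0 * (n j / 2 ^ j - m j / 2 ^ j)\<bar>
            \<le> e * (n j / 2 ^ j - m j / 2 ^ j)"
      proof eventually_elim
        case (elim j)
        have "\<bar>fwd_diff (x j) i - Y t\<^sub>0 / 2 ^ j\<bar> \<le> e / 2 ^ j" if "m j \<le> i" "i < n j" for i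
        proof -
          define t where "t = i / 2 ^ j"
          have "2 ^ j * a < m j + 1" unfolding m_def by linarith
          also have "\<dots> \<le> i + 1" using that by simp
          finally have "a < t + (1/2) ^ j" by (simp add: t_def power_divide field_simps)
          moreover have "i \<le> 2 ^ j * b" using that unfolding n_def by linarith
          then have "t \<le> b" by (simp add: t_def field_simps)
          ultimately have "\<bar>t - t\<^sub>0\<bar> < \<eta>'" using ab elim by linarith
          then have "\<bar>2 ^ j * fwd_diff (x j) i - Y t\<^sub>0\<bar> \<le> e"
            using \<eta>'(2)[of t] spec[OF elim(1), of t]
              abs_triangle_ineq[of "2 ^ j * fwd_diff (x j) i - Y t" "Y t - Y t\<^sub>0"]
            by (simp add: t_def)
          moreover have "2 ^ j * fwd_diff (x j) i - Y t\<^sub>0 = 2 ^ j * (fwd_diff (x j) i - Y t\<^sub>0 / 2 ^ j)"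
            by (simp add: right_diff_distrib)
          ultimately show ?thesis by (simp add: abs_mult field_simps)
        qed
        moreover have "m j \<le> n j"
          unfolding m_def n_def using ab by (intro floor_mono) simp
        ultimately have "\<bar>x j (n j) - x j (m j) - Y t\<^sub>0 / 2 ^ j * (n j - m j)\<bar>
            \<le> e / 2 ^ j * (n j - m j)"
          by (intro increments_near_slope) auto
        then show ?case by (simp add: diff_divide_distrib right_diff_distrib)
      qed
      moreover have grid: "(\<lambda>j. \<lfloor>2 ^ j * t\<rfloor> / 2 ^ j) \<longlonglongrightarrow> t" for t :: real
      proof (rule tendsto_sandwich)
        show "\<forall>\<^sub>F j in sequentially. t - (1/2) ^ j \<le> \<lfloor>2 ^ j * t\<rfloor> / 2 ^ j"
        proof (intro always_eventually allI)
          fix j :: nat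
          have "2 ^ j * t - 1 \<le> \<lfloor>2 ^ j * t\<rfloor>" by linarith
          then have "(2 ^ j * t - 1) / 2 ^ j \<le> \<lfloor>2 ^ j * t\<rfloor> / 2 ^ j"
            by (rule divide_right_mono) simp
          then show "t - (1/2) ^ j \<le> \<lfloor>2 ^ j * t\<rfloor> / 2 ^ j"
            by (simp add: diff_divide_distrib power_divide)
        qed
        show "\<forall>\<^sub>F j in sequentially. \<lfloor>2 ^ j * t\<rfloor> / 2 ^ j \<le> t"
          by (intro always_eventually allI) (simp add: field_simps)
        have "(\<lambda>j. t - (1/2) ^ j) \<longlonglongrightarrow> t - 0"
          by (intro tendsto_intros LIMSEQ_power_zero) simp
        then show "(\<lambda>j. t - (1/2) ^ j) \<longlonglongrightarrow> t" by simp
      qed simp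
      ultimately show ?thesis
        unfolding n_def m_def
        by (intro tendsto_le[OF sequentially_bot _ _ _]) (auto intro!: tendsto_intros X)
    qed
    then show ?thesis using \<eta>'(1) by (intro exI[of _ "\<eta>' / 2"]) auto
  qed
  have "\<exists>\<eta>>0. \<forall>y. \<bar>y - t\<^sub>0\<bar> < \<eta> \<longrightarrow> \<bar>X y - X t\<^sub>0 - Y t\<^sub>0 * (y - t\<^sub>0)\<bar> \<le> e * \<bar>y - t\<^sub>0\<bar>"
    if "0 < e" for e
  proof -
    obtain \<eta> where \<eta>: "0 < \<eta>" "\<And>a b. \<bar>a - t\<^sub>0\<bar> < \<eta> \<Longrightarrow> \<bar>b - t\<^sub>0\<bar> < \<eta> \<Longrightarrow> a \<le> b
        \<Longrightarrow> \<bar>X b - X a - Y t\<^sub>0 * (b - a)\<bar> \<le> e * (b - a)"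
      using close[OF \<open>0 < e\<close>] by auto
    have "\<bar>X y - X t\<^sub>0 - Y t\<^sub>0 * (y - t\<^sub>0)\<bar> \<le> e * \<bar>y - t\<^sub>0\<bar>" if "\<bar>y - t\<^sub>0\<bar> < \<eta>" for y
    proof (cases "t\<^sub>0 \<le> y")
      case True
      then show ?thesis using \<eta>(2)[of t\<^sub>0 y] \<eta>(1) that by simp
    next
      case False
      then show ?thesis using \<eta>(2)[of y t\<^sub>0] \<eta>(1) that by (simp add: algebra_simps abs_le_iff)
    qed
    then show ?thesis using \<eta>(1) by blast
  qed
  then show ?thesis
    unfolding has_field_derivative_def has_derivative_at_alt
    by (auto simp: bounded_linear_mult_right)
qed

section \<open>Hoelder continuity\<close>

text \<open>Boundedness is included so that the class is closed under products.\<close>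

definition holder :: "real \<Rightarrow> (real \<Rightarrow> 'a::real_normed_vector) \<Rightarrow> bool" where
  "holder \<alpha> f \<longleftrightarrow> bounded (range f) \<and> (\<exists>M. \<forall>x y. norm (f x - f y) \<le> M * \<bar>x - y\<bar> powr \<alpha>)"

lemma holder_continuous:
  assumes "holder \<alpha> f" "0 < \<alpha>"
  shows "isCont f t"
proof -
  obtain M where M: "\<And>x y. norm (f x - f y) \<le> M * \<bar>x - y\<bar> powr \<alpha>"
    using assms(1) unfolding holder_def by blast
  have "((\<lambda>x. \<bar>x - t\<bar> powr \<alpha>) \<longlongrightarrow> 0 powr \<alpha>) (at t)"
    using \<open>0 < \<alpha>\<close> by (intro tendsto_powr') (auto intro!: tendsto_eq_intros)
  then have "((\<lambda>x. M * \<bar>x - t\<bar> powr \<alpha>) \<longlongrightarrow> 0) (at t)"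
    by (auto intro: tendsto_mult_right_zero)
  then have "((\<lambda>x. f x - f t) \<longlongrightarrow> 0) (at t)"
    by (rule Lim_null_comparison[rotated]) (simp add: M)
  then show ?thesis unfolding isCont_def by (rule LIM_zero_cancel)
qed

lemma holder_add:
  assumes "holder \<alpha> f" "holder \<alpha> g"
  shows "holder \<alpha> (\<lambda>t. f t + g t)"
proof -
  obtain M M' where M: "\<And>x y. norm (f x - f y) \<le> M * \<bar>x - y\<bar> powr \<alpha>"
    "\<And>x y. norm (g x - g y) \<le> M' * \<bar>x - y\<bar> powr \<alpha>"
    using assms unfolding holder_def by blast
  have "norm (f x + g x - (f y + g y)) \<le> (M + M') * \<bar>x - y\<bar> powr \<alpha>" for x y
    using norm_triangle_ineq[of "f x - f y" "g x - g y"] M(1)[of x y] M(2)[of x y]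
    by (simp add: algebra_simps)
  moreover have "bounded (range (\<lambda>t. f t + g t))"
    using assms unfolding holder_def by (blast intro: bounded_plus_comp)
  ultimately show ?thesis unfolding holder_def by blast
qed

lemma holder_scaleR:
  assumes "holder \<alpha> f" "holder \<alpha> g"
  shows "holder \<alpha> (\<lambda>t. f t *\<^sub>R g t)"
proof -
  obtain M M' where M: "\<And>x y. norm (f x - f y) \<le> M * \<bar>x - y\<bar> powr \<alpha>"
    "\<And>x y. norm (g x - g y) \<le> M' * \<bar>x - y\<bar> powr \<alpha>"
    using assms unfolding holder_def by blast
  obtain F G where FG: "\<And>x. norm (f x) \<le> F" "\<And>x. norm (g x) \<le> G"
    using assms unfolding holder_def bounded_iff by blast
  have "0 \<le> F" "0 \<le> G" using order_trans[OF norm_ge_zero FG(1)] order_trans[OF norm_ge_zero FG(2)] .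
  have "norm (f x *\<^sub>R g x - f y *\<^sub>R g y) \<le> (F * M' + M * G) * \<bar>x - y\<bar> powr \<alpha>" for x y
  proof -
    have "f x *\<^sub>R g x - f y *\<^sub>R g y = f x *\<^sub>R (g x - g y) + (f x - f y) *\<^sub>R g y"
      by (simp add: algebra_simps)
    also have "norm \<dots> \<le> norm (f x) * norm (g x - g y) + norm (f x - f y) * norm (g y)"
      by (rule norm_triangle_le) simp
    also have "\<dots> \<le> F * (M' * \<bar>x - y\<bar> powr \<alpha>) + (M * \<bar>x - y\<bar> powr \<alpha>) * G"
      using M(1)[of x y] M(2)[of x y] FG \<open>0 \<le> F\<close>
      by (intro add_mono mult_mono) (auto intro: order_trans[OF norm_ge_zero])
    finally show ?thesis by (simp add: algebra_simps)
  qed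
  moreover have "norm (f x *\<^sub>R g x) \<le> F * G" for x
    using FG \<open>0 \<le> F\<close> by (auto intro: mult_mono)
  then have "bounded (range (\<lambda>t. f t *\<^sub>R g t))" unfolding bounded_iff by blast
  ultimately show ?thesis unfolding holder_def by blast
qed

text \<open>Up to distance 1 the Lipschitz bound is the stronger one because
  \<open>\<alpha> \<le> 1\<close>; beyond distance 1 the bound on \<open>f\<close> itself
  suffices.\<close>

lemma holder_of_bounded_derivative:
  assumes deriv: "\<And>t. (f has_vector_derivative f' t) (at t)"
    and "bounded (range f)" "bounded (range f')" "0 < \<alpha>" "\<alpha> \<le> 1"
  shows "holder \<alpha> f"
proof -
  obtain F F' where F: "\<And>x. norm (f x) \<le> F" "\<And>x. norm (f' x) \<le> F'"
    using assms unfolding bounded_iff by blast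
  have "0 \<le> F" "0 \<le> F'"
    using order_trans[OF norm_ge_zero F(1)] order_trans[OF norm_ge_zero F(2)] .
  have lip: "norm (f x - f y) \<le> F' * \<bar>x - y\<bar>" for x y
  proof -
    have "norm (f x - f y) \<le> F' * norm (x - y)"
    proof (rule differentiable_bound[of UNIV f "\<lambda>t h. h *\<^sub>R f' t"])
      fix t
      show "(f has_derivative (\<lambda>h. h *\<^sub>R f' t)) (at t within UNIV)"
        using deriv[of t] by (simp add: has_vector_derivative_def)
      show "onorm (\<lambda>h. h *\<^sub>R f' t) \<le> F'"
        by (rule onorm_bound) (use F(2)[of t] \<open>0 \<le> F'\<close> in \<open>auto simp: mult.commute[of F'] intro!: mult_left_mono\<close>)
    qed auto
    then show ?thesis by simp
  qed
  have "norm (f x - f y) \<le> (2 * F + F') * \<bar>x - y\<bar> powr \<alpha>" for x y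
  proof (cases "\<bar>x - y\<bar> \<le> 1")
    case True
    have "\<bar>x - y\<bar> \<le> \<bar>x - y\<bar> powr \<alpha>"
      using powr_mono'[of \<alpha> 1 "\<bar>x - y\<bar>"] True assms by simp
    then have "F' * \<bar>x - y\<bar> \<le> (2 * F + F') * \<bar>x - y\<bar> powr \<alpha>"
      using \<open>0 \<le> F\<close> \<open>0 \<le> F'\<close> by (intro mult_mono) auto
    with lip[of x y] show ?thesis by linarith
  next
    case False
    then have "1 \<le> \<bar>x - y\<bar> powr \<alpha>" using assms by (intro ge_one_powr_ge_zero) auto
    then have "2 * F * 1 \<le> (2 * F + F') * \<bar>x - y\<bar> powr \<alpha>"
      using \<open>0 \<le> F\<close> \<open>0 \<le> F'\<close> by (intro mult_mono) auto
    moreover have "norm (f x - f y) \<le> 2 * F"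
      using norm_triangle_ineq4[of "f x" "f y"] F(1)[of x] F(1)[of y] by linarith
    ultimately show ?thesis by linarith
  qed
  then show ?thesis using assms(2) unfolding holder_def by blast
qed

section \<open>Smoothness of limits of perturbed B-spline subdivision\<close>

text \<open>The scaled first and second differences \<open>x 1\<close> and \<open>x 2\<close>
  satisfy the hypotheses of \<open>dyadic_limit\<close>, and their limits are the derivatives
  \<open>\<beta>\<close> and \<open>\<gamma>\<close>. The condition \<open>\<alpha> < 1\<close> is
  what allows the linear growth of the third differences.\<close>

lemma perturbed_subdivision_limit:
  fixes s :: "nat \<Rightarrow> int \<Rightarrow> real"
  assumes "3 \<le> p"
    and step: "\<And>j K. \<bar>s (Suc j) K - subdiv p (s j) K\<bar> \<le> A * (1/8) ^ j"
    and diff: "\<And>j i. \<bar>fwd_diff (s j) i\<bar> \<le> B * (1/2) ^ j"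
    and \<sigma>: "\<And>t. (\<lambda>j. s j \<lfloor>2 ^ j * t\<rfloor>) \<longlonglongrightarrow> \<sigma> t"
    and "0 < \<alpha>" "\<alpha> < 1"
  obtains \<beta> \<gamma> where "\<And>t. (\<sigma> has_real_derivative \<beta> t) (at t)"
    "\<And>t. (\<beta> has_real_derivative \<gamma> t) (at t)" "holder \<alpha> \<beta>" "holder \<alpha> \<gamma>"
proof -
  define x where "x r j i = 2 ^ (r * j) * (fwd_diff ^^ r) (s j) i" for r j i
  define \<theta> where "\<theta> = 2 powr - \<alpha>"
  have "0 < \<theta>" "\<theta> < 1" "1/2 < \<theta>"
    using \<open>0 < \<alpha>\<close> \<open>\<alpha> < 1\<close> powr_less_mono[of "- 1" "- \<alpha>" 2]
    by (simp_all add: \<theta>_def powr_less_one powr_minus_divide)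
  have "0 \<le> A" "0 \<le> B"
    using order_trans[OF abs_ge_zero step[of 0 0]] order_trans[OF abs_ge_zero diff[of 0 0]] by simp_all
  have diff_x: "2 ^ j * fwd_diff (x r j) i = x (Suc r) j i" for r j i
    by (simp add: x_def[abs_def] fwd_diff_mult power_add)
  \<comment> \<open>For r = 3 the quotient \<open>2 ^ r / 8\<close> is 1, so every level adds
    \<open>4 ^ 3 * A\<close>; the lower orders share this bound. At level 0, r - 1 further
    differences of the increments cost at most \<open>2 ^ 2\<close>.\<close>
  have bound: "\<bar>x r j i\<bar> \<le> 4 * B + 64 * A * j" if "1 \<le> r" "r \<le> 3" for r j i
  proof (induction j arbitrary: i)
    case 0
    obtain q where q: "r = Suc q" using \<open>1 \<le> r\<close> by (cases r) auto
    have "\<bar>(fwd_diff ^^ q) (fwd_diff (s 0)) i\<bar> \<le> 2 ^ q * B"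
      by (rule fwd_diffs_bound) (use diff[of 0] in simp)
    also have "\<dots> \<le> 2 ^ 2 * B"
      using q \<open>r \<le> 3\<close> \<open>0 \<le> B\<close> by (intro mult_right_mono power_increasing) auto
    finally show ?case by (simp add: x_def q funpow_swap1)
  next
    case (Suc j)
    have "\<bar>x r (Suc j) i\<bar> \<le> 4 * B + 64 * A * j + 4 ^ r * A * (2 ^ r / 8) ^ j"
      unfolding x_def
    proof (rule scaled_diffs_bound[OF step])
      show "r \<le> p" using \<open>r \<le> 3\<close> \<open>3 \<le> p\<close> by simp
      show "\<bar>2 ^ (r * j) * (fwd_diff ^^ r) (s j) i\<bar> \<le> 4 * B + 64 * A * real j" for i
        using Suc.IH[of i] by (simp add: x_def)
    qed
    also have "4 ^ r * A * (2 ^ r / 8) ^ j \<le> 4 ^ 3 * A * 1 ^ j"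
    proof -
      have "(2::real) ^ r \<le> 2 ^ 3" using \<open>r \<le> 3\<close> by (intro power_increasing) auto
      then show ?thesis
        using \<open>r \<le> 3\<close> \<open>0 \<le> A\<close> by (intro mult_mono power_mono power_increasing) auto
    qed
    finally show ?case by (simp add: algebra_simps)
  qed
  \<comment> \<open>As \<open>2 * \<theta> > 1\<close>, the linear factor is absorbed by passing
    from the rate \<open>(1/2) ^ j\<close> to the slower rate \<open>\<theta> ^ j\<close>.\<close>
  have "(\<lambda>j. (1 + real j) * (1 / (2 * \<theta>)) ^ j) \<longlonglongrightarrow> 0"
  proof -
    have "norm (1 / (2 * \<theta>)) < 1" using \<open>1/2 < \<theta>\<close> by simp
    from tendsto_add[OF LIMSEQ_power_zero[OF this] powser_times_n_limit_0[OF this]]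
    show ?thesis by (simp add: algebra_simps)
  qed
  then have "Bseq (\<lambda>j. (1 + real j) * (1 / (2 * \<theta>)) ^ j)"
    by (intro convergent_imp_Bseq convergentI)
  then obtain K where "0 < K" and K: "\<And>j. (1 + real j) * (1 / (2 * \<theta>)) ^ j \<le> K"
    unfolding Bseq_def by (metis abs_le_D1 real_norm_def)
  define A' where "A' = (4 * B + 64 * A) * K"
  have "0 \<le> A'" using \<open>0 \<le> A\<close> \<open>0 \<le> B\<close> \<open>0 < K\<close> by (simp add: A'_def)
  have diff_bound: "\<bar>fwd_diff (x r j) i\<bar> \<le> A' * \<theta> ^ j" if "r \<le> 2" for r j i
  proof -
    have "2 ^ j * \<bar>fwd_diff (x r j) i\<bar> = \<bar>x (Suc r) j i\<bar>"
      by (simp add: abs_mult flip: diff_x)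
    also have "\<dots> \<le> 4 * B + 64 * A * j"
      using that by (intro bound) auto
    also have "\<dots> \<le> (4 * B + 64 * A) * (1 + real j)"
      using \<open>0 \<le> A\<close> \<open>0 \<le> B\<close> by (simp add: algebra_simps)
    also have "\<dots> \<le> (4 * B + 64 * A) * (K * (2 * \<theta>) ^ j)"
    proof (rule mult_left_mono)
      show "1 + real j \<le> K * (2 * \<theta>) ^ j"
        using K[of j] \<open>0 < \<theta>\<close> by (simp add: power_divide field_simps)
    qed (use \<open>0 \<le> A\<close> \<open>0 \<le> B\<close> in simp)
    also have "\<dots> = 2 ^ j * (A' * \<theta> ^ j)"
      by (simp add: A'_def power_mult_distrib)
    finally show ?thesis by simp
  qed
  \<comment> \<open>The perturbation contributes \<open>16 * A\<close>, as
    \<open>4 ^ r \<le> 16\<close> and \<open>2 ^ r / 8 \<le> 1/2 < \<theta>\<close>; replacing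
    \<open>S_(p-r)\<close> by the coarse entry contributes \<open>p * A'\<close>.\<close>
  have step_bound: "\<bar>x r (Suc j) i - x r j (i div 2)\<bar> \<le> (real p * A' + 16 * A) * \<theta> ^ j"
    if "r \<le> 2" for r j i
  proof -
    have "\<bar>x r (Suc j) i - subdiv (p - r) (x r j) i\<bar> \<le> 4 ^ r * A * (2 ^ r / 8) ^ j"
      using scaled_diffs_step[OF step, of r j i] that \<open>3 \<le> p\<close> by (simp add: x_def[abs_def])
    also have "\<dots> \<le> 4 ^ 2 * A * \<theta> ^ j"
    proof -
      have "(2::real) ^ r \<le> 2 ^ 2" using \<open>r \<le> 2\<close> by (intro power_increasing) auto
      then show ?thesis
        using \<open>r \<le> 2\<close> \<open>0 \<le> A\<close> \<open>1/2 < \<theta>\<close> by (intro mult_mono power_mono power_increasing) auto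
    qed
    finally have "\<bar>x r (Suc j) i - subdiv (p - r) (x r j) i\<bar> \<le> 16 * A * \<theta> ^ j" by simp
    moreover have "\<bar>subdiv (p - r) (x r j) i - x r j (i div 2)\<bar> \<le> real (p - r) * (A' * \<theta> ^ j)"
      using subdiv_near[of "x r j" "A' * \<theta> ^ j" "p - r" i] diff_bound[OF that] by simp
    moreover have "real (p - r) * (A' * \<theta> ^ j) \<le> real p * (A' * \<theta> ^ j)"
      using \<open>0 \<le> A'\<close> \<open>0 < \<theta>\<close> by (intro mult_right_mono) auto
    ultimately show ?thesis by (simp add: algebra_simps)
  qed
  \<comment> \<open>Order 0 is left out: the parameters themselves grow by \<open>L\<close> in each
    period of the application, whereas \<open>dyadic_limit\<close> asks for a bounded level 0. Their
    limit is the given \<open>\<sigma>\<close>.\<close>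
  have limit: "\<exists>X. (uniform_limit UNIV (\<lambda>j t. x r j \<lfloor>2 ^ j * t\<rfloor>) X sequentially) \<and> holder \<alpha> X"
    if "1 \<le> r" "r \<le> 2" for r
  proof -
    have "A' * \<theta> ^ j \<le> (real p * A' + 16 * A + A') * \<theta> ^ j"
      "(real p * A' + 16 * A) * \<theta> ^ j \<le> (real p * A' + 16 * A + A') * \<theta> ^ j" for j
      using \<open>0 \<le> A\<close> \<open>0 \<le> A'\<close> \<open>0 < \<theta>\<close> by (auto intro!: mult_right_mono)
    then have 1: "\<bar>x r (Suc j) i - x r j (i div 2)\<bar> \<le> (real p * A' + 16 * A + A') * \<theta> ^ j"
      and 2: "\<bar>fwd_diff (x r j) i\<bar> \<le> (real p * A' + 16 * A + A') * \<theta> ^ j" for j i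
      using step_bound[OF \<open>r \<le> 2\<close>, of j i] diff_bound[OF \<open>r \<le> 2\<close>, of j i] order_trans by blast+
    have 3: "\<bar>x r 0 i\<bar> \<le> 4 * B" for i
      using bound[of r 0 i] that by simp
    obtain X D H where X: "\<And>j t. \<bar>X t - x r j \<lfloor>2 ^ j * t\<rfloor>\<bar> \<le> D * \<theta> ^ j" "bounded (range X)"
      "\<And>a b. \<bar>X a - X b\<bar> \<le> H * \<bar>a - b\<bar> powr \<alpha>"
      using dyadic_limit[OF \<open>0 < \<alpha>\<close> 1[unfolded \<theta>_def] 2[unfolded \<theta>_def] 3]
      unfolding \<theta>_def by blast
    have "(\<lambda>j. D * \<theta> ^ j) \<longlonglongrightarrow> 0"
      using \<open>0 < \<theta>\<close> \<open>\<theta> < 1\<close> by (auto intro!: tendsto_mult_right_zero LIMSEQ_power_zero)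
    have "uniform_limit UNIV (\<lambda>j t. x r j \<lfloor>2 ^ j * t\<rfloor>) X sequentially"
    proof (rule uniform_limitI)
      fix e :: real assume "0 < e"
      then have "\<forall>\<^sub>F j in sequentially. D * \<theta> ^ j < e"
        using \<open>(\<lambda>j. D * \<theta> ^ j) \<longlonglongrightarrow> 0\<close> by (rule order_tendstoD(2)[rotated])
      then show "\<forall>\<^sub>F j in sequentially. \<forall>t\<in>UNIV. dist (x r j \<lfloor>2 ^ j * t\<rfloor>) (X t) < e"
        by eventually_elim
          (auto simp: dist_real_def abs_minus_commute intro: le_less_trans[OF X(1)])
    qed
    moreover have "holder \<alpha> X" using X unfolding holder_def by auto
    ultimately show ?thesis by blast
  qed
  obtain \<beta> where \<beta>: "uniform_limit UNIV (\<lambda>j t. x 1 j \<lfloor>2 ^ j * t\<rfloor>) \<beta> sequentially" "holder \<alpha> \<beta>"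
    using limit[of 1] by auto
  obtain \<gamma> where \<gamma>: "uniform_limit UNIV (\<lambda>j t. x 2 j \<lfloor>2 ^ j * t\<rfloor>) \<gamma> sequentially" "holder \<alpha> \<gamma>"
    using limit[of 2] by auto
  have "(\<sigma> has_real_derivative \<beta> t) (at t)" for t
  proof (rule dyadic_limit_deriv[where x = s and X = \<sigma>, OF \<sigma>])
    show "uniform_limit UNIV (\<lambda>j t. 2 ^ j * fwd_diff (s j) \<lfloor>2 ^ j * t\<rfloor>) \<beta> sequentially"
      using \<beta>(1) by (simp add: x_def)
  qed (rule holder_continuous[OF \<beta>(2) \<open>0 < \<alpha>\<close>])
  moreover have "(\<beta> has_real_derivative \<gamma> t) (at t)" for t
  proof (rule dyadic_limit_deriv[where x = "x 1"])
    show "(\<lambda>j. x 1 j \<lfloor>2 ^ j * t\<rfloor>) \<longlonglongrightarrow> \<beta> t" for t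
      using tendsto_uniform_limitI[OF \<beta>(1)] by simp
    show "uniform_limit UNIV (\<lambda>j t. 2 ^ j * fwd_diff (x 1 j) \<lfloor>2 ^ j * t\<rfloor>) \<gamma> sequentially"
      unfolding diff_x using \<gamma>(1) by (simp add: numeral_2_eq_2)
  qed (rule holder_continuous[OF \<gamma>(2) \<open>0 < \<alpha>\<close>])
  ultimately show ?thesis using that \<beta>(2) \<gamma>(2) by blast
qed

section \<open>Piecewise linear interpolants\<close>

lemma pl_interp_eq:
  assumes "of_int m \<le> 2 ^ j * t" "2 ^ j * t \<le> of_int m + 1"
  shows "pl_interp j x t = x m + (2 ^ j * t - m) * fwd_diff x m"
proof (cases "2 ^ j * t = of_int (m + 1)")
  case True
  then show ?thesis unfolding pl_interp_def True by (simp add: fwd_diff_def)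
next
  case False
  then have "\<lfloor>2 ^ j * t\<rfloor> = m" using assms by (intro floor_unique) auto
  then show ?thesis by (simp add: pl_interp_def frac_def fwd_diff_def algebra_simps)
qed

lemma pl_interp_near_step:
  assumes "\<And>i. \<bar>fwd_diff x i\<bar> \<le> \<delta>"
  shows "\<bar>pl_interp j x t - x \<lfloor>2 ^ j * t\<rfloor>\<bar> \<le> \<delta>"
proof -
  have "pl_interp j x t - x \<lfloor>2 ^ j * t\<rfloor> = frac (2 ^ j * t) * fwd_diff x \<lfloor>2 ^ j * t\<rfloor>"
    using pl_interp_eq[of "\<lfloor>2 ^ j * t\<rfloor>" j t x] by (simp add: frac_def)
  also have "\<bar>\<dots>\<bar> \<le> 1 * \<delta>"
    unfolding abs_mult using assms frac_lt_1[of "2 ^ j * t"]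
    by (intro mult_mono) (auto simp: less_imp_le)
  finally show ?thesis by simp
qed

text \<open>An increment of a fine level \<open>J\<close> is a difference of values of its
  interpolant. Passing through \<open>\<sigma>\<close> to the fixed level \<open>j0\<close> costs
  four errors below \<open>\<epsilon> / 5\<close>; the interpolant of level \<open>j0\<close> has
  slopes at most \<open>L * 2 ^ j0\<close>, so over one fine cell it varies by less than the fifth
  \<open>\<epsilon> / 5\<close>.\<close>

lemma uniform_limit_small_increments:
  assumes lim: "uniform_limit UNIV (\<lambda>j. pl_interp j (s j)) \<sigma> sequentially"
    and bounded: "\<And>j i. \<bar>fwd_diff (s j) i\<bar> \<le> L"
    and "0 < \<epsilon>"
  shows "\<exists>J. \<forall>i. \<bar>fwd_diff (s J) i\<bar> \<le> \<epsilon>"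
proof -
  obtain j0 where j0: "\<And>j t. j0 \<le> j \<Longrightarrow> \<bar>pl_interp j (s j) t - \<sigma> t\<bar> < \<epsilon> / 5"
    using uniform_limitD[OF lim, of "\<epsilon> / 5"] \<open>0 < \<epsilon>\<close>
    by (auto simp: eventually_sequentially dist_real_def)
  have "0 \<le> L" using order_trans[OF abs_ge_zero bounded] .
  have "(\<lambda>k. L * (1/2) ^ k) \<longlonglongrightarrow> 0"
    by (intro tendsto_mult_right_zero LIMSEQ_power_zero) simp
  then have "\<forall>\<^sub>F k in sequentially. L * (1/2) ^ k < \<epsilon> / 5"
    using \<open>0 < \<epsilon>\<close> by (intro order_tendstoD(2)) auto
  then obtain k where k: "L * (1/2) ^ k < \<epsilon> / 5"
    using eventually_happens sequentially_bot by blast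
  define J where "J = j0 + k"
  have "\<bar>fwd_diff (s J) i\<bar> \<le> \<epsilon>" for i
  proof -
    define a b m where "a = i / 2 ^ J" and "b = (i + 1) / 2 ^ J" and "m = i div 2 ^ k"
    have grid: "s J n = pl_interp J (s J) (n / 2 ^ J)" for n
      using pl_interp_eq[of n J "n / 2 ^ J" "s J"] by simp
    have ab: "2 ^ j0 * a = i / 2 ^ k" "2 ^ j0 * b = (i + 1) / 2 ^ k"
      by (simp_all add: a_def b_def J_def power_add)
    have "i = m * 2 ^ k + i mod 2 ^ k" "0 \<le> i mod 2 ^ k" "i mod 2 ^ k < 2 ^ k"
      by (simp_all only: m_def div_mult_mod_eq) simp_all
    \<comment> \<open>The fine cell from \<open>a\<close> to \<open>b\<close> lies inside the single
      cell \<open>m\<close> of level \<open>j0\<close>, where the interpolant is linear.\<close>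
    then have "m * 2 ^ k \<le> i" "i + 1 \<le> (m + 1) * 2 ^ k"
      unfolding distrib_right by linarith+
    then have "real_of_int (m * 2 ^ k) \<le> i" "real_of_int (i + 1) \<le> real_of_int ((m + 1) * 2 ^ k)"
      by (simp_all only: of_int_le_iff)
    then have "m \<le> 2 ^ j0 * a" "2 ^ j0 * b \<le> m + 1" "2 ^ j0 * a \<le> 2 ^ j0 * b"
      unfolding ab by (simp_all add: field_simps)
    then have "m \<le> 2 ^ j0 * a" "2 ^ j0 * a \<le> m + 1" "m \<le> 2 ^ j0 * b" "2 ^ j0 * b \<le> m + 1"
      by linarith+
    then have "pl_interp j0 (s j0) b - pl_interp j0 (s j0) a
        = (2 ^ j0 * b - 2 ^ j0 * a) * fwd_diff (s j0) m"
      by (simp add: pl_interp_eq[of m] left_diff_distrib)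
    also have "\<dots> = (1/2) ^ k * fwd_diff (s j0) m"
      unfolding ab by (simp add: power_divide add_divide_distrib)
    also have "\<bar>\<dots>\<bar> \<le> L * (1/2) ^ k"
      using bounded[of j0 m] by (simp add: abs_mult mult.commute mult_right_mono)
    finally have "\<bar>pl_interp j0 (s j0) b - pl_interp j0 (s j0) a\<bar> < \<epsilon> / 5"
      using k by linarith
    moreover have "fwd_diff (s J) i = pl_interp J (s J) b - pl_interp J (s J) a"
      using grid[of i] grid[of "i + 1"] by (simp add: fwd_diff_def a_def b_def)
    moreover have "j0 \<le> J" by (simp add: J_def)
    ultimately show ?thesis
      using j0[of J a] j0[of J b] j0[of j0 a] j0[of j0 b]
      unfolding abs_le_iff abs_less_iff by linarith
  qed
  then show ?thesis by blast
qed

section \<open>Tangential projection\<close>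

lemma arclength_taylor_tangent:
  fixes v :: "real \<Rightarrow> 'a::real_inner"
  assumes v1: "\<And>t. (v has_vector_derivative v1 t) (at t)"
    and v2: "\<And>t. (v1 has_vector_derivative v2 t) (at t)"
    and v3: "\<And>t. (v2 has_vector_derivative v3 t) (at t)"
    and unit: "\<And>t. norm (v1 t) = 1"
    and M: "\<And>t. norm (v3 t) \<le> M"
  shows "\<bar>(v z - v \<xi>) \<bullet> v1 \<xi> - (z - \<xi>)\<bar> \<le> M * \<bar>z - \<xi>\<bar> ^ 3"
proof -
  have "((\<lambda>t. v1 t \<bullet> v1 t) has_vector_derivative v1 \<xi> \<bullet> v2 \<xi> + v2 \<xi> \<bullet> v1 \<xi>) (at \<xi>)"
    by (rule bounded_bilinear.has_vector_derivative[OF bounded_bilinear_inner v2 v2])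
  moreover have "(\<lambda>t. v1 t \<bullet> v1 t) = (\<lambda>t. 1)"
    using unit by (simp add: dot_square_norm)
  ultimately have "v1 \<xi> \<bullet> v2 \<xi> + v2 \<xi> \<bullet> v1 \<xi> = 0"
    using vector_derivative_unique_at has_vector_derivative_const by metis
  then have normal: "v2 \<xi> \<bullet> v1 \<xi> = 0" by (simp add: inner_commute)
  have inner_deriv: "((\<lambda>u. w (\<xi> + u) \<bullet> v1 \<xi>) has_real_derivative w' (\<xi> + u) \<bullet> v1 \<xi>) (at u)"
    if "\<And>t. (w has_vector_derivative w' t) (at t)" for w w' u
  proof -
    have "((\<lambda>t. w t \<bullet> v1 \<xi>) has_real_derivative w' (\<xi> + u) \<bullet> v1 \<xi>) (at (\<xi> + u))"
      using bounded_linear.has_vector_derivative[OF bounded_linear_inner_left that]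
      by (simp add: has_real_derivative_iff_has_vector_derivative)
    then show ?thesis
      using DERIV_shift[of "\<lambda>t. w t \<bullet> v1 \<xi>" "w' (\<xi> + u) \<bullet> v1 \<xi>" u \<xi>]
      by (simp add: add.commute)
  qed
  \<comment> \<open>The list holds the function of the claim, recentred at \<open>\<xi>\<close>, and
    its first three derivatives. The first three entries vanish at 0, so the Maclaurin formula
    leaves only the cubic remainder.\<close>
  define diff where "diff m u = [(v (\<xi> + u) - v \<xi>) \<bullet> v1 \<xi> - u, v1 (\<xi> + u) \<bullet> v1 \<xi> - 1,
    v2 (\<xi> + u) \<bullet> v1 \<xi>, v3 (\<xi> + u) \<bullet> v1 \<xi>] ! m" for m u
  have "(diff m has_real_derivative diff (Suc m) u) (at u)" if "m < 3" for m u
  proof -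
    consider "m = 0" | "m = 1" | "m = 2" using \<open>m < 3\<close> by linarith
    then show ?thesis
    proof cases
      case 1
      have "((\<lambda>u. v (\<xi> + u) \<bullet> v1 \<xi> - v \<xi> \<bullet> v1 \<xi> - u) has_real_derivative v1 (\<xi> + u) \<bullet> v1 \<xi> - 0 - 1) (at u)"
        by (intro derivative_intros inner_deriv v1)
      then show ?thesis by (simp add: diff_def[abs_def] 1 inner_diff_left)
    next
      case 2
      have "((\<lambda>u. v1 (\<xi> + u) \<bullet> v1 \<xi> - 1) has_real_derivative v2 (\<xi> + u) \<bullet> v1 \<xi> - 0) (at u)"
        by (intro derivative_intros inner_deriv v2)
      then show ?thesis by (simp add: diff_def[abs_def] 2)
    next
      case 3
      show ?thesis
        using inner_deriv[OF v3, of u] by (simp add: diff_def[abs_def] 3 numeral_2_eq_2)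
    qed
  qed
  then obtain t where "diff 0 (z - \<xi>) =
      (\<Sum>m<3. diff m 0 / fact m * (z - \<xi>) ^ m) + diff 3 t / fact 3 * (z - \<xi>) ^ 3"
    using Maclaurin_bi_le[of diff "diff 0" 3 "z - \<xi>"] by blast
  moreover have "(\<Sum>m<3. diff m 0 / fact m * (z - \<xi>) ^ m) = 0"
    using normal unit by (simp add: diff_def numeral_3_eq_3 dot_square_norm)
  ultimately have "diff 0 (z - \<xi>) = diff 3 t / 6 * (z - \<xi>) ^ 3"
    by (simp add: fact_numeral)
  moreover have "\<bar>diff 3 t\<bar> \<le> M"
    using Cauchy_Schwarz_ineq2[of "v3 (\<xi> + t)" "v1 \<xi>"] M[of "\<xi> + t"] unit
    by (simp add: diff_def numeral_3_eq_3)
  then have "\<bar>diff 3 t / 6\<bar> * \<bar>z - \<xi>\<bar> ^ 3 \<le> M * \<bar>z - \<xi>\<bar> ^ 3"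
    by (intro mult_right_mono) auto
  ultimately have "\<bar>diff 0 (z - \<xi>)\<bar> \<le> M * \<bar>z - \<xi>\<bar> ^ 3"
    by (simp only: abs_mult power_abs)
  then show ?thesis by (simp add: diff_def)
qed

text \<open>Subdivision commutes with pairing against \<open>T\<close> and reproduces constants, so
  the linear part of \<open>v\<close> along \<open>T\<close> turns into subdivision of the
  parameters. One cubic error comes from the new point and one from the average, hence the factor
  2.\<close>

lemma tangential_subdivision_error:
  fixes v :: "real \<Rightarrow> 'a::real_inner"
  assumes taylor: "\<And>z. \<bar>(v z - v \<xi>) \<bullet> T - (z - \<xi>)\<bar> \<le> M * \<bar>z - \<xi>\<bar> ^ 3"
    and "0 \<le> M"
    and orth: "(v z - subdiv p (\<lambda>i. v (x i)) K) \<bullet> T = 0"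
    and near: "\<And>k. K div 2 \<le> k \<Longrightarrow> k \<le> (K + int p) div 2 \<Longrightarrow> \<bar>x k - \<xi>\<bar> \<le> r"
    and z: "\<bar>z - \<xi>\<bar> \<le> r"
  shows "\<bar>z - subdiv p x K\<bar> \<le> 2 * M * r ^ 3"
proof -
  define g where "g z = (v z - v \<xi>) \<bullet> T - (z - \<xi>)" for z
  define c where "c = v \<xi> \<bullet> T - \<xi>"
  have g: "\<bar>g y\<bar> \<le> M * r ^ 3" if "\<bar>y - \<xi>\<bar> \<le> r" for y
  proof -
    have "\<bar>g y\<bar> \<le> M * \<bar>y - \<xi>\<bar> ^ 3" using taylor by (simp add: g_def)
    also have "\<dots> \<le> M * r ^ 3" using that \<open>0 \<le> M\<close> by (intro mult_left_mono power_mono) auto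
    finally show ?thesis .
  qed
  have vT: "v y \<bullet> T = g y + (y + c)" for y
    by (simp add: g_def c_def inner_diff_left)
  have "subdiv p (\<lambda>i. v (x i)) K \<bullet> T = subdiv p (\<lambda>i. v (x i) \<bullet> T) K"
    by (rule subdiv_linear[symmetric]) (simp add: bounded_linear.linear bounded_linear_inner_left)
  also have "\<dots> = subdiv p (\<lambda>i. g (x i)) K + (subdiv p x K + c)"
    by (simp add: vT subdiv_add subdiv_const)
  finally have "g z + z = subdiv p (\<lambda>i. g (x i)) K + subdiv p x K"
    using orth by (simp add: inner_diff_left vT)
  moreover have "\<bar>subdiv p (\<lambda>i. g (x i)) K\<bar> \<le> M * r ^ 3"
    using subdiv_norm_le[of K p "\<lambda>i. g (x i)" "M * r ^ 3"] near g by simp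
  ultimately show ?thesis using g[OF z] by linarith
qed

section \<open>Periodic functions and local maxima\<close>

lemma periodic_bounded:
  fixes f :: "real \<Rightarrow> 'a::real_normed_vector"
  assumes "continuous_on UNIV f" "0 < L" and periodic: "\<And>s. f (s + L) = f s"
  shows "bounded (range f)"
proof -
  have shift: "f (s + real n * L) = f s" for s n
    using periodic by (induction n arbitrary: s) (simp_all add: algebra_simps flip: add.assoc)
  have "f t \<in> f ` {0..L}" for t
  proof -
    define k where "k = \<lfloor>t / L\<rfloor>"
    have "k * L \<le> t" "t \<le> (k + 1) * L"
      using \<open>0 < L\<close> floor_divide_lower[of L t] floor_divide_upper[of L t]
      by (simp_all add: k_def)
    then have "t - k * L \<in> {0..L}" by (simp add: algebra_simps)
    moreover have "f (t - k * L) = f t"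
    proof (cases "0 \<le> k")
      case True
      then show ?thesis using shift[of "t - k * L" "nat k"] by simp
    next
      case False
      then show ?thesis using shift[of t "nat (- k)"] by simp
    qed
    ultimately show ?thesis by (metis imageI)
  qed
  moreover have "bounded (f ` {0..L})"
    using assms(1) by (intro compact_imp_bounded compact_continuous_image) (auto intro: continuous_on_subset)
  ultimately show ?thesis by (meson bounded_subset image_subsetI)
qed

lemma has_vector_derivative_periodic:
  assumes deriv: "\<And>t. (f has_vector_derivative f' t) (at t)"
    and periodic: "\<And>s. f (s + L) = f s"
  shows "f' (s + L) = f' s"
proof -
  have "((\<lambda>u. u + L) has_vector_derivative 1) (at s)"
    by (auto intro!: derivative_eq_intros)
  from vector_diff_chain_at[OF this deriv]
  have "(f has_vector_derivative f' (s + L)) (at s)"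
    by (simp add: o_def periodic)
  then show ?thesis using deriv vector_derivative_unique_at by blast
qed

lemma local_norm_bounds:
  assumes "finite A" "A \<noteq> {}" "\<And>i. \<bar>x i\<bar> \<le> \<delta>"
  shows "0 \<le> local_norm A x" "local_norm A x \<le> \<delta>"
proof -
  obtain a where "a \<in> A" using \<open>A \<noteq> {}\<close> by blast
  have "0 \<le> \<bar>x a\<bar>" by simp
  also have "\<dots> \<le> local_norm A x"
    unfolding local_norm_def using \<open>finite A\<close> \<open>a \<in> A\<close> by (intro Max_ge) auto
  finally show "0 \<le> local_norm A x" .
  show "local_norm A x \<le> \<delta>"
    unfolding local_norm_def using assms by (intro Max.boundedI) auto
qed

section \<open>Regularity of the normal re-parametrization\<close>

lemma nth_deriv_0: "nth_deriv 0 f = f"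
  by (simp add: nth_deriv_def)

lemma nth_deriv_Suc: "nth_deriv (Suc k) f = (\<lambda>t. vector_derivative (nth_deriv k f) (at t))"
  by (simp add: nth_deriv_def)

lemma Ck_Hoelder_2I:
  assumes "\<And>t. (f has_vector_derivative f1 t) (at t)"
    and "\<And>t. (f1 has_vector_derivative f2 t) (at t)"
    and "holder \<alpha> f2" "0 < \<alpha>"
  shows "Ck_Hoelder 2 \<alpha> f"
proof -
  have f1: "nth_deriv 1 f = f1"
    using assms(1) by (auto simp: nth_deriv_Suc nth_deriv_0 vector_derivative_at)
  have f2: "nth_deriv 2 f = f2"
    using assms(2) f1 by (auto simp: numeral_2_eq_2 nth_deriv_Suc vector_derivative_at)
  have "nth_deriv m f differentiable (at t)" if "m < 2" for m t
    using that assms(1,2)[THEN differentiableI_vector] f1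
    by (auto simp: less_2_cases_iff nth_deriv_0)
  moreover have "continuous_on UNIV f2"
    using holder_continuous[OF assms(3,4)] by (simp add: continuous_at_imp_continuous_on)
  ultimately show ?thesis
    using assms(3) by (auto simp: Ck_Hoelder_def Ck_def f2 holder_def)
qed

theorem theorem3p1:
  fixes p N :: nat and L C1 :: real and v :: "real \<Rightarrow> complex" and \<rho> :: complex
    and s0 :: "int \<Rightarrow> real" and nhat :: "nat \<Rightarrow> int \<Rightarrow> complex"
    and s d \<xi> :: "nat \<Rightarrow> int \<Rightarrow> real"
  assumes "p \<ge> 3"
    and "closed_arclength_curve v L"
    and "Ck 3 v"
    and "quarter_turn \<rho>"
    and "initial_params L N s0"
    and "well_posed_transform p v L N s0 nhat d s"
    and "convergent_transform s"
    and "\<And>j i K. j \<ge> 1 \<Longrightarrow> K \<in> stencil p (2 * i) \<union> stencil p (2 * i + 1) \<Longrightarrow>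
           nhat j K = unit_normal \<rho> v (\<xi> j K)"
    and "\<And>j i K k. j \<ge> 1 \<Longrightarrow> K \<in> stencil p (2 * i) \<union> stencil p (2 * i + 1) \<Longrightarrow>
           k \<in> stencil p i \<Longrightarrow>
           \<bar>\<xi> j K - s (j - 1) k\<bar> \<le> C1 * local_norm (stencil p i) (fwd_diff (s (j - 1)))"
    and "\<And>j i K. j \<ge> 1 \<Longrightarrow> K \<in> stencil p (2 * i) \<union> stencil p (2 * i + 1) \<Longrightarrow>
           \<bar>s j K - \<xi> j K\<bar> \<le> C1 * local_norm (stencil p i) (fwd_diff (s (j - 1)))"
  shows "Ck_1minus 2 (normal_reparam v s)"
proof -
  define v1 v2 v3 where "v1 = nth_deriv 1 v" and "v2 = nth_deriv 2 v" and "v3 = nth_deriv 3 v"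
  have deriv: "(nth_deriv m v has_vector_derivative nth_deriv (Suc m) v t) (at t)" if "m < 3" for m t
    using \<open>Ck 3 v\<close> that by (auto simp: Ck_def nth_deriv_Suc simp flip: vector_derivative_works)
  have v1: "(v has_vector_derivative v1 t) (at t)" for t
    using deriv[of 0 t] by (simp add: v1_def nth_deriv_0)
  have v2: "(v1 has_vector_derivative v2 t) (at t)" for t
    using deriv[of 1 t] by (simp add: v1_def v2_def numeral_2_eq_2)
  have v3: "(v2 has_vector_derivative v3 t) (at t)" for t
    using deriv[of 2 t] by (simp add: v2_def v3_def)
  have curve: "0 < L" "v (t + L) = v t" "norm (v1 t) = 1" for t
    using \<open>closed_arclength_curve v L\<close>
    by (auto simp: closed_arclength_curve_def v1_def nth_deriv_Suc nth_deriv_0)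
  have v1_per: "v1 (t + L) = v1 t" for t
    by (rule has_vector_derivative_periodic[OF v1 curve(2)])
  have v2_per: "v2 (t + L) = v2 t" for t
    by (rule has_vector_derivative_periodic[OF v2 v1_per])
  have v3_per: "v3 (t + L) = v3 t" for t
    by (rule has_vector_derivative_periodic[OF v3 v2_per])
  have "continuous_on UNIV v2"
    using v3 by (meson continuous_at_imp_continuous_on has_vector_derivative_continuous)
  then have v2_bounded: "bounded (range v2)"
    using curve(1) v2_per by (rule periodic_bounded)
  have v3_bounded: "bounded (range v3)"
    using \<open>Ck 3 v\<close> curve(1) v3_per by (intro periodic_bounded[of v3 L]) (auto simp: Ck_def v3_def)
  have v1_bounded: "bounded (range v1)"
    using curve(3) by (auto simp: bounded_iff)
  obtain M where M: "\<And>t. norm (v3 t) \<le> M"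
    using v3_bounded by (auto simp: bounded_iff)
  have "0 \<le> M" using order_trans[OF norm_ge_zero M] .

  have "0 < N" using assms(5) by (simp add: initial_params_def)
  have mono: "strict_mono (s j)" and per: "s j (i + 2 ^ j * int N) = s j i + L" for j i
    using assms(6) by (auto simp: well_posed_transform_def normal_transform_def)
  have lift: "v (s j K) - subdiv p (\<lambda>i. v (s (j - 1) i)) K = d j K *\<^sub>R nhat j K" if "1 \<le> j" for j K
    using assms(6) that by (auto simp: well_posed_transform_def normal_transform_def)
  have bounded: "\<bar>fwd_diff (s j) i\<bar> \<le> L" for j i
  proof -
    have "s j i < s j (i + 1)" using mono by (simp add: strict_monoD)
    \<comment> \<open>Neighbouring indices are at most one period apart, so monotonicity bounds an
      increment by \<open>L\<close>.\<close>
    have "1 \<le> 2 ^ j * int N" using \<open>0 < N\<close> by (simp add: Suc_leI int_one_le_iff_zero_less)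
    then have "s j (i + 1) \<le> s j (i + 2 ^ j * int N)"
      using mono[of j] by (simp add: strict_mono_less_eq)
    with \<open>s j i < s j (i + 1)\<close> per show ?thesis by (simp add: fwd_diff_def)
  qed
  obtain \<sigma> where \<sigma>: "uniform_limit UNIV (\<lambda>j. pl_interp j (s j)) \<sigma> sequentially"
    using assms(7) by (auto simp: convergent_transform_def)

  define C where "C = 2 * M * \<bar>C1\<bar> ^ 3"
  have step: "\<bar>s (Suc j) K - subdiv p (s j) K\<bar> \<le> C * \<delta> ^ 3"
    if \<delta>: "\<And>i. \<bar>fwd_diff (s j) i\<bar> \<le> \<delta>" for j \<delta> K
  proof -
    \<comment> \<open>With this \<open>i\<close>, the stencil of \<open>i\<close> contains all
      coarse indices from \<open>K div 2\<close> to \<open>(K + p) div 2\<close>, and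
      \<open>K\<close> is \<open>2 * i\<close> or \<open>2 * i + 1\<close>, the first element of one
      of the fine stencils.\<close>
    define i where "i = K div 2"
    have K: "K \<in> stencil p (2 * i) \<union> stencil p (2 * i + 1)"
      by (simp add: stencil_def i_def) presburger
    \<comment> \<open>\<open>C1\<close> may have either sign, hence the absolute value; the estimate
      also uses that the local norm is nonnegative.\<close>
    have norm_le: "C1 * local_norm (stencil p i) (fwd_diff (s j)) \<le> \<bar>C1\<bar> * \<delta>"
      using local_norm_bounds[of "stencil p i" "fwd_diff (s j)" \<delta>] \<delta>
      by (intro mult_mono) (auto simp: stencil_def)
    define T where "T = v1 (\<xi> (Suc j) K)"
    have "nhat (Suc j) K = \<rho> * T"
      using assms(8)[OF _ K, of "Suc j"]
      by (simp add: unit_normal_def T_def v1_def nth_deriv_Suc nth_deriv_0)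
    \<comment> \<open>Pairing with the tangent at \<open>\<xi>\<close> removes the unknown
      \<open>d\<close> from the equation of the transform.\<close>
    then have "nhat (Suc j) K \<bullet> T = 0"
      using \<open>quarter_turn \<rho>\<close> by (auto simp: quarter_turn_def inner_complex_def)
    then have "(v (s (Suc j) K) - subdiv p (\<lambda>i. v (s j i)) K) \<bullet> T = 0"
      using lift[of "Suc j" K] by simp
    moreover have "\<bar>(v z - v (\<xi> (Suc j) K)) \<bullet> T - (z - \<xi> (Suc j) K)\<bar> \<le> M * \<bar>z - \<xi> (Suc j) K\<bar> ^ 3" for z
      unfolding T_def by (rule arclength_taylor_tangent[OF v1 v2 v3 curve(3) M])
    moreover have "\<bar>s j k - \<xi> (Suc j) K\<bar> \<le> \<bar>C1\<bar> * \<delta>"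
      if "K div 2 \<le> k" "k \<le> (K + int p) div 2" for k
    proof -
      have "k \<in> stencil p i" using that by (auto simp: stencil_def i_def)
      then show ?thesis
        using assms(9)[of "Suc j" K i k] K norm_le by (simp add: abs_minus_commute)
    qed
    moreover have "\<bar>s (Suc j) K - \<xi> (Suc j) K\<bar> \<le> \<bar>C1\<bar> * \<delta>"
      using assms(10)[of "Suc j" K i] K norm_le by simp
    ultimately have "\<bar>s (Suc j) K - subdiv p (s j) K\<bar> \<le> 2 * M * (\<bar>C1\<bar> * \<delta>) ^ 3"
      using \<open>0 \<le> M\<close> by (intro tangential_subdivision_error[of v "\<xi> (Suc j) K" T]) auto
    then show ?thesis by (simp add: C_def power_mult_distrib)
  qed

  have "1 \<le> p" "0 \<le> C" using \<open>p \<ge> 3\<close> \<open>0 \<le> M\<close> by (simp_all add: C_def)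
  then obtain B where B: "0 \<le> B" "\<And>j i. \<bar>fwd_diff (s j) i\<bar> \<le> B * (1/2) ^ j"
    using increments_decay[OF _ _ bounded step uniform_limit_small_increments[OF \<sigma> bounded]] by blast
  have error: "\<bar>s (Suc j) K - subdiv p (s j) K\<bar> \<le> (C * B ^ 3) * (1/8) ^ j" for j K
  proof -
    have "((1/2 :: real) ^ j) ^ 3 = (1/8) ^ j"
      by (simp add: power3_eq_cube flip: power_mult_distrib)
    then show ?thesis using step[OF B(2), of j K] by (simp add: power_mult_distrib)
  qed
  have pointwise: "(\<lambda>j. pl_interp j (s j) t) \<longlonglongrightarrow> \<sigma> t" for t
    using tendsto_uniform_limitI[OF \<sigma>] by simp
  \<comment> \<open>Convergence is given for the interpolants; it carries over to the step functions
    because the two differ by at most one increment.\<close>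
  have \<sigma>_step: "(\<lambda>j. s j \<lfloor>2 ^ j * t\<rfloor>) \<longlonglongrightarrow> \<sigma> t" for t
  proof -
    have "(\<lambda>j. B * (1/2) ^ j) \<longlonglongrightarrow> 0"
      by (intro tendsto_mult_right_zero LIMSEQ_power_zero) simp
    then have "(\<lambda>j. pl_interp j (s j) t - s j \<lfloor>2 ^ j * t\<rfloor>) \<longlonglongrightarrow> 0"
      by (rule Lim_null_comparison[rotated])
        (use pl_interp_near_step[OF B(2)] in \<open>auto intro: always_eventually\<close>)
    from tendsto_diff[OF pointwise[of t] this] show ?thesis by simp
  qed
  have reparam: "normal_reparam v s = (\<lambda>t. v (\<sigma> t))"
    by (rule ext) (simp add: normal_reparam_def limI[OF pointwise])

  have "Ck_Hoelder 2 \<alpha> (\<lambda>t. v (\<sigma> t))" if \<alpha>: "0 < \<alpha>" "\<alpha> < 1" for \<alpha>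
  proof -
    obtain \<beta> \<gamma> where \<beta>: "\<And>t. (\<sigma> has_real_derivative \<beta> t) (at t)"
      and \<gamma>: "\<And>t. (\<beta> has_real_derivative \<gamma> t) (at t)"
      and holder: "holder \<alpha> \<beta>" "holder \<alpha> \<gamma>"
      using perturbed_subdivision_limit[OF \<open>p \<ge> 3\<close> error B(2) \<sigma>_step \<alpha>] by blast
    have chain: "((\<lambda>t. w (\<sigma> t)) has_vector_derivative \<beta> t *\<^sub>R w' (\<sigma> t)) (at t)"
      if "\<And>t. (w has_vector_derivative w' t) (at t)" for w :: "real \<Rightarrow> complex" and w' t
      using vector_diff_chain_at[OF \<beta>[unfolded has_real_derivative_iff_has_vector_derivative] that]
      by (simp add: o_def)
    have holder_comp: "holder \<alpha> (\<lambda>t. w (\<sigma> t))"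
      if w: "\<And>t. (w has_vector_derivative w' t) (at t)"
        and "bounded (range w)" "bounded (range w')" for w w' :: "real \<Rightarrow> complex"
    proof (rule holder_of_bounded_derivative[OF chain[OF w]])
      show "bounded (range (\<lambda>t. w (\<sigma> t)))"
        using \<open>bounded (range w)\<close> by (auto intro: bounded_subset)
      obtain b where b: "\<And>t. norm (\<beta> t) \<le> b"
        using holder(1) by (auto simp: holder_def bounded_iff)
      obtain b' where b': "\<And>t. norm (w' t) \<le> b'"
        using \<open>bounded (range w')\<close> by (auto simp: bounded_iff)
      have "norm (\<beta> t *\<^sub>R w' (\<sigma> t)) \<le> b * b'" for t
        unfolding norm_scaleR real_norm_def [symmetric]
        using b[of t] b' order_trans[OF norm_ge_zero b] by (intro mult_mono) auto
      then show "bounded (range (\<lambda>t. \<beta> t *\<^sub>R w' (\<sigma> t)))"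
        unfolding bounded_iff by blast
    qed (use \<alpha> in auto)
    show ?thesis
    proof (rule Ck_Hoelder_2I)
      show "((\<lambda>t. v (\<sigma> t)) has_vector_derivative \<beta> t *\<^sub>R v1 (\<sigma> t)) (at t)" for t
        by (rule chain[OF v1])
      show "((\<lambda>t. \<beta> t *\<^sub>R v1 (\<sigma> t)) has_vector_derivative
          \<beta> t *\<^sub>R \<beta> t *\<^sub>R v2 (\<sigma> t) + \<gamma> t *\<^sub>R v1 (\<sigma> t)) (at t)" for t
        by (rule has_vector_derivative_scaleR[OF \<gamma> chain[OF v2]])
      \<comment> \<open>The third derivative of the curve enters here through its boundedness, which
        makes \<open>v2\<close> composed with \<open>\<sigma>\<close> Hoelder continuous.\<close>
      show "holder \<alpha> (\<lambda>t. \<beta> t *\<^sub>R \<beta> t *\<^sub>R v2 (\<sigma> t) + \<gamma> t *\<^sub>R v1 (\<sigma> t))"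
        by (intro holder_add holder_scaleR holder holder_comp[OF v2] holder_comp[OF v3]
            v1_bounded v2_bounded v3_bounded)
    qed (rule \<open>0 < \<alpha>\<close>)
  qed
  then show ?thesis by (simp add: Ck_1minus_def reparam)
qed

end
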